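(* Let $H$ be a graph on $k$ nodes having an independent set of size $s$. Given a graph $G$ on $n$ nodes with integer weights on its nodes and edges, the minimum total weight (sum of node weights and edge weights) of a (not necessarily induced) subgraph of $G$ that is isomorphic to $H$ can be found in time $\tilde O(n^{k-s+1})$.
   Context: $\tilde O$ hides polylogarithmic factors in $n$; $k$ is treated as a constant. *)

theory Defs
  imports Complex_Main "HOL-Library.Landau_Symbols"
begin

section \<open>Weighted graphs and copies of a pattern graph\<close>

datatype 'a graph = Graph (verts: "'a set") (edges: "'a set set")

definition simple_graph :: "'a graph \<Rightarrow> bool" where
  "simple_graph G \<longleftrightarrow> finite (verts G) \<and> (\<forall>e\<in>edges G. e \<subseteq> verts G \<and> card e = 2)"

definition independent_set :: "'a graph \<Rightarrow> 'a set \<Rightarrow> bool" where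
  "independent_set G I \<longleftrightarrow> I \<subseteq> verts G \<and> (\<forall>u\<in>I. \<forall>v\<in>I. {u, v} \<notin> edges G)"

definition subgraph :: "'a graph \<Rightarrow> 'a graph \<Rightarrow> bool" where
  "subgraph K G \<longleftrightarrow> simple_graph K \<and> verts K \<subseteq> verts G \<and> edges K \<subseteq> edges G"

definition isomorphic :: "'a graph \<Rightarrow> 'b graph \<Rightarrow> bool" where
  "isomorphic H K \<longleftrightarrow>
     (\<exists>f. bij_betw f (verts H) (verts K) \<and>
          (\<forall>u\<in>verts H. \<forall>v\<in>verts H. {u, v} \<in> edges H \<longleftrightarrow> {f u, f v} \<in> edges K))"

definition copies :: "'a graph \<Rightarrow> 'b graph \<Rightarrow> 'b graph set" where
  "copies H G = {K. subgraph K G \<and> isomorphic H K}"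

definition total_weight :: "('b \<Rightarrow> int) \<Rightarrow> ('b set \<Rightarrow> int) \<Rightarrow> 'b graph \<Rightarrow> int" where
  "total_weight nw ew K = (\<Sum>v\<in>verts K. nw v) + (\<Sum>e\<in>edges K. ew e)"

text \<open>The value \<open>None\<close> means that \<open>G\<close> has no subgraph isomorphic to \<open>H\<close>.\<close>

definition min_copy_weight ::
  "'a graph \<Rightarrow> 'b graph \<Rightarrow> ('b \<Rightarrow> int) \<Rightarrow> ('b set \<Rightarrow> int) \<Rightarrow> int option" where
  "min_copy_weight H G nw ew =
     (if copies H G = {} then None else Some (Min (total_weight nw ew ` copies H G)))"

lemma finite_copies:
  assumes "simple_graph G"
  shows "finite (copies H G)"
proof (rule finite_subset)
  have "finite (verts G)" "edges G \<subseteq> Pow (verts G)"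
    using assms by (auto simp: simple_graph_def)
  then have "finite (edges G)"
    using finite_subset by blast
  with \<open>finite (verts G)\<close>
  show "finite ((\<lambda>(V, E). Graph V E) ` (Pow (verts G) \<times> Pow (edges G)))"
    by simp
  show "copies H G \<subseteq> (\<lambda>(V, E). Graph V E) ` (Pow (verts G) \<times> Pow (edges G))"
  proof
    fix K assume "K \<in> copies H G"
    then have "(verts K, edges K) \<in> Pow (verts G) \<times> Pow (edges G)"
      by (simp add: copies_def subgraph_def)
    moreover have "K = (\<lambda>(V, E). Graph V E) (verts K, edges K)"
      by simp
    ultimately show "K \<in> (\<lambda>(V, E). Graph V E) ` (Pow (verts G) \<times> Pow (edges G))"
      by (rule rev_image_eqI)
  qed
qed


section \<open>A word RAM\<close>

text \<open>
  A program is a finite list of instructions acting on a register file and on a random-access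
  memory; the fixed program mentions only finitely many registers.  Every executed instruction
  costs one unit.  Registers and memory cells hold \<open>w\<close>-bit integers with a sign.  The machine is
  stuck, without having halted, as soon as a result does not fit into a word or a negative
  address is used.  A run halts when the program counter leaves the program.
\<close>

datatype instr =
    Const nat int      \<comment> \<open>\<open>Const r x\<close>: \<open>R r := x\<close>\<close>
  | Add nat nat nat    \<comment> \<open>\<open>Add r a b\<close>: \<open>R r := R a + R b\<close>\<close>
  | Sub nat nat nat
  | Mul nat nat nat
  | Load nat nat       \<comment> \<open>\<open>Load r a\<close>: \<open>R r := M (R a)\<close>\<close>
  | Store nat nat      \<comment> \<open>\<open>Store a r\<close>: \<open>M (R a) := R r\<close>\<close>
  | JumpLe nat nat nat \<comment> \<open>\<open>JumpLe a b l\<close>: continue at instruction \<open>l\<close> if \<open>R a \<le> R b\<close>\<close>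

datatype config = Config (pc: nat) (regs: "nat \<Rightarrow> int") (mem: "nat \<Rightarrow> int")

definition is_word :: "nat \<Rightarrow> int \<Rightarrow> bool" where
  "is_word w x \<longleftrightarrow> \<bar>x\<bar> < 2 ^ w"

inductive step :: "nat \<Rightarrow> instr list \<Rightarrow> config \<Rightarrow> config \<Rightarrow> bool" for w P where
  Const: "i < length P \<Longrightarrow> P ! i = Const r x \<Longrightarrow> is_word w x \<Longrightarrow>
    step w P (Config i R M) (Config (i + 1) (R(r := x)) M)"
| Add: "i < length P \<Longrightarrow> P ! i = Add r a b \<Longrightarrow> is_word w (R a + R b) \<Longrightarrow>
    step w P (Config i R M) (Config (i + 1) (R(r := R a + R b)) M)"
| Sub: "i < length P \<Longrightarrow> P ! i = Sub r a b \<Longrightarrow> is_word w (R a - R b) \<Longrightarrow>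
    step w P (Config i R M) (Config (i + 1) (R(r := R a - R b)) M)"
| Mul: "i < length P \<Longrightarrow> P ! i = Mul r a b \<Longrightarrow> is_word w (R a * R b) \<Longrightarrow>
    step w P (Config i R M) (Config (i + 1) (R(r := R a * R b)) M)"
| Load: "i < length P \<Longrightarrow> P ! i = Load r a \<Longrightarrow> 0 \<le> R a \<Longrightarrow>
    step w P (Config i R M) (Config (i + 1) (R(r := M (nat (R a)))) M)"
| Store: "i < length P \<Longrightarrow> P ! i = Store a r \<Longrightarrow> 0 \<le> R a \<Longrightarrow>
    step w P (Config i R M) (Config (i + 1) R (M(nat (R a) := R r)))"
| JumpLe: "i < length P \<Longrightarrow> P ! i = JumpLe a b l \<Longrightarrow>
    step w P (Config i R M) (Config (if R a \<le> R b then l else i + 1) R M)"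

lemma step_deterministic: "step w P c c' \<Longrightarrow> step w P c c'' \<Longrightarrow> c' = c''"
  by (auto elim!: step.cases)

definition halts_in :: "nat \<Rightarrow> instr list \<Rightarrow> config \<Rightarrow> nat \<Rightarrow> config \<Rightarrow> bool" where
  "halts_in w P c t c' \<longleftrightarrow> (step w P ^^ t) c c' \<and> length P \<le> pc c'"


section \<open>Input and output conventions\<close>

text \<open>
  The host graph has vertices \<open>0, \<dots>, n - 1\<close>.  The memory holds the \<open>n\<close> node weights,
  followed by the \<open>n \<times> n\<close> adjacency matrix and the \<open>n \<times> n\<close> matrix of edge weights, both
  stored row by row.  Register 0 initially holds \<open>n\<close>; all other registers and cells hold 0.
\<close>

definition input_mem ::
  "nat \<Rightarrow> nat graph \<Rightarrow> (nat \<Rightarrow> int) \<Rightarrow> (nat set \<Rightarrow> int) \<Rightarrow> nat \<Rightarrow> int" where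
  "input_mem n G nw ew a =
     (let adj = (\<lambda>b. {b div n, b mod n} \<in> edges G);
          wt = (\<lambda>b. if adj b then ew {b div n, b mod n} else 0)
      in if a < n then nw a
         else if a < n + n * n then of_bool (adj (a - n))
         else if a < n + 2 * (n * n) then wt (a - n - n * n)
         else 0)"

definition initial ::
  "nat \<Rightarrow> nat graph \<Rightarrow> (nat \<Rightarrow> int) \<Rightarrow> (nat set \<Rightarrow> int) \<Rightarrow> config" where
  "initial n G nw ew = Config 0 ((\<lambda>_. 0)(0 := int n)) (input_mem n G nw ew)"

definition result :: "config \<Rightarrow> int option" where
  "result c = (if regs c 0 = 0 then None else Some (regs c 1))"

text \<open>
  \<open>solves_min_copy H P T\<close>: the program \<open>P\<close> finds the minimum weight of a copy of \<open>H\<close> in every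
  node- and edge-weighted graph on \<open>n\<close> vertices within \<open>T n\<close> steps.  If \<open>W\<close> bounds the absolute
  values of the weights, any word length that is at least a suitable constant times
  \<open>log (n + W)\<close> suffices; \<open>T\<close> depends neither on \<open>W\<close> nor on the word length.
\<close>

definition solves_min_copy :: "'a graph \<Rightarrow> instr list \<Rightarrow> (nat \<Rightarrow> nat) \<Rightarrow> bool" where
  "solves_min_copy H P T \<longleftrightarrow>
     (\<exists>d :: nat. \<forall>n (G :: nat graph) nw ew (W :: nat) (w :: nat).
        simple_graph G \<longrightarrow> verts G = {..<n} \<longrightarrow>
        (\<forall>v\<in>verts G. \<bar>nw v\<bar> \<le> int W) \<longrightarrow> (\<forall>e\<in>edges G. \<bar>ew e\<bar> \<le> int W) \<longrightarrow>
        real d * log 2 (real (n + W + 2)) \<le> real w \<longrightarrow>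
        (\<exists>t c. t \<le> T n \<and> halts_in w P (initial n G nw ew) t c \<and>
               result c = min_copy_weight H G nw ew))"

definition soft_O :: "(nat \<Rightarrow> real) \<Rightarrow> (nat \<Rightarrow> real) set" where
  "soft_O g = {f. \<exists>c :: nat. f \<in> O(\<lambda>n. g n * ln (real n) ^ c)}"

end

theory Submission
  imports Defs "HOL-Library.Nat_Bijection"
begin

text \<open>
  Let \<open>I\<close> be the independent set and \<open>U\<close> the other \<open>k - s\<close> vertices of \<open>H\<close>.  All \<open>n\<^sup>k\<^sup>-\<^sup>s\<close> maps of \<open>U\<close>
  into \<open>G\<close> are enumerated by nested loops.  Once the images of \<open>U\<close> are fixed, the weight contributed
  by mapping \<open>i \<in> I\<close> to \<open>v\<close> depends on \<open>i\<close> and \<open>v\<close> only, because \<open>I\<close> is independent; it remains to find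
  a cheapest injective assignment of the \<open>s\<close> elements of \<open>I\<close> to host vertices.  This takes time
  \<open>O(n)\<close> by dynamic programming: scan the host vertices \<open>v = 0, \<dots>, n - 1\<close> and keep, for each of the
  \<open>2\<^sup>s\<close> subsets \<open>S\<close> of \<open>I\<close>, the least cost of assigning \<open>S\<close> to vertices seen so far.  The table fits
  into registers, so the memory is only read.
\<close>

section \<open>A structured language on top of the word RAM\<close>

text \<open>The machine gets stuck on overflow, so no large number can stand for an infinite cost.
  Optional values therefore carry a 0/1 flag, and an invalid candidate is still added up, with a
  bounded value and flag 0. Since the arithmetic has to fit into words for every candidate, valid or
  not, the rules keep a budget: each value is a sum of at most \<open>K\<close> weights, where
  \<open>K\<close> depends on \<open>H\<close> alone. This is why a word length proportional to
  log(n + W) is enough.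

  The registers are specified by sets: a pair of registers is described by the set of costs of which
  it holds the minimum. The effect of the code is then a set operation, correctness is an equation
  between sets of costs, and \<open>Min\<close> is taken only at the end.

  Copies need not be induced, so they come from injective edge-preserving maps of the vertices of
  \<open>H\<close>. Several maps may yield the same copy, but the set of weights stays the
  same.\<close>

datatype com = Skip | Ins instr | Seq com com (infixr ";;" 60) | When nat nat com | For nat com

text \<open>Loop counters are compared with register 0, which holds \<open>n\<close>, and incremented by
  register 3, which holds 1.\<close>

fun code :: "com \<Rightarrow> nat \<Rightarrow> instr list" where
  "code Skip i = []"
| "code (Ins a) i = [a]"
| "code (c ;; d) i = code c i @ code d (i + length (code c i))"
| "code (When a b c) i =
     JumpLe a b (i + 2) # JumpLe 0 0 (i + 2 + length (code c (i + 2))) # code c (i + 2)"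
| "code (For x c) i =
     Const x 0 # JumpLe 0 x (i + 4 + length (code c (i + 2))) # code c (i + 2)
       @ [Add x x 3, JumpLe 0 0 (i + 1)]"

text \<open>An upper bound rather than an exact count: a \<open>When\<close> executes one jump if
  its body runs and two if it is skipped. Each round of a \<open>For\<close> adds the exit test, the
  increment and the jump back; the 2 outside is the initialisation and the final test.\<close>

fun time :: "nat \<Rightarrow> com \<Rightarrow> nat" where
  "time n Skip = 0"
| "time n (Ins a) = 1"
| "time n (c ;; d) = time n c + time n d"
| "time n (When a b c) = 2 + time n c"
| "time n (For x c) = 2 + n * (time n c + 3)"

text \<open>Jump targets are absolute, so the code of \<open>c\<close> depends on the address
  \<open>i\<close> at which it is placed.\<close>

definition code_at :: "instr list \<Rightarrow> nat \<Rightarrow> com \<Rightarrow> bool" where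
  "code_at P i c \<longleftrightarrow> (\<exists>p q. P = p @ code c i @ q \<and> length p = i)"

lemma code_at_Ins: "code_at P i (Ins a) \<Longrightarrow> i < length P \<and> P ! i = a"
  by (auto simp: code_at_def)

lemma code_at_Seq:
  assumes "code_at P i (c ;; d)"
  shows "code_at P i c" and "code_at P (i + length (code c i)) d"
proof -
  from assms obtain p q where P: "P = p @ code c i @ code d (i + length (code c i)) @ q" "length p = i"
    by (auto simp: code_at_def)
  from P show "code_at P i c"
    unfolding code_at_def by blast
  have "P = (p @ code c i) @ code d (i + length (code c i)) @ q"
       "length (p @ code c i) = i + length (code c i)"
    using P by simp_all
  then show "code_at P (i + length (code c i)) d"
    unfolding code_at_def by blast
qed

lemma code_at_When:
  assumes "code_at P i (When a b c)"
  shows "i + 1 < length P" and "P ! i = JumpLe a b (i + 2)"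
    and "P ! (i + 1) = JumpLe 0 0 (i + 2 + length (code c (i + 2)))"
    and "code_at P (i + 2) c"
proof -
  from assms obtain p q where P: "P = p @ code (When a b c) i @ q" "length p = i"
    by (auto simp: code_at_def)
  from P show "i + 1 < length P" "P ! i = JumpLe a b (i + 2)"
    "P ! (i + 1) = JumpLe 0 0 (i + 2 + length (code c (i + 2)))"
    by (auto simp: nth_append)
  have "P = (p @ [JumpLe a b (i + 2), JumpLe 0 0 (i + 2 + length (code c (i + 2)))])
          @ code c (i + 2) @ q"
    using P by simp
  moreover have "length (p @ [JumpLe a b (i + 2),
      JumpLe 0 0 (i + 2 + length (code c (i + 2)))]) = i + 2"
    using P by simp
  ultimately show "code_at P (i + 2) c"
    unfolding code_at_def by blast
qed

lemma code_at_For: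
  assumes "code_at P i (For x c)"
  defines "j \<equiv> i + 2 + length (code c (i + 2))"
  shows "j + 1 < length P" and "P ! i = Const x 0" and "P ! (i + 1) = JumpLe 0 x (j + 2)"
    and "P ! j = Add x x 3" and "P ! (j + 1) = JumpLe 0 0 (i + 1)"
    and "code_at P (i + 2) c"
proof -
  from assms obtain p q where P: "P = p @ code (For x c) i @ q" "length p = i"
    by (auto simp: code_at_def)
  define pre where "pre = p @ [Const x 0, JumpLe 0 x (j + 2)]"
  have P': "P = pre @ code c (i + 2) @ ([Add x x 3, JumpLe 0 0 (i + 1)] @ q)"
    "length pre = i + 2"
    using P by (auto simp: pre_def j_def)
  from P' show "code_at P (i + 2) c"
    unfolding code_at_def by blast
  from P show "P ! i = Const x 0" "P ! (i + 1) = JumpLe 0 x (j + 2)"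
    by (auto simp: nth_append j_def)
  from P' show "j + 1 < length P" "P ! j = Add x x 3" "P ! (j + 1) = JumpLe 0 0 (i + 1)"
    by (auto simp: nth_append j_def)
qed

definition reach :: "nat \<Rightarrow> instr list \<Rightarrow> nat \<Rightarrow> config \<Rightarrow> config \<Rightarrow> bool" where
  "reach w P b c c' \<longleftrightarrow> (\<exists>t\<le>b. (step w P ^^ t) c c')"

lemma reach_refl: "reach w P b c c"
  unfolding reach_def by (intro exI[of _ 0]) auto

lemma reach_step: "step w P c c' \<Longrightarrow> reach w P 1 c c'"
  unfolding reach_def by (intro exI[of _ 1]) auto

lemma reach_trans: "reach w P a c c' \<Longrightarrow> reach w P b c' c'' \<Longrightarrow> reach w P (a + b) c c''"
  unfolding reach_def by (metis relpowp_trans add_mono)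

lemma reach_mono: "reach w P a c c' \<Longrightarrow> a \<le> b \<Longrightarrow> reach w P b c c'"
  unfolding reach_def by (meson order_trans)

section \<open>Weakest preconditions with a built-in step bound\<close>

locale machine =
  fixes w n :: nat and M :: "nat \<Rightarrow> int"
begin

text \<open>The final registers are chosen before the program and the address, so one statement
  serves wherever the code is placed. The same \<open>M\<close> appears before and after the run,
  since the search only reads the memory.\<close>

definition wp :: "com \<Rightarrow> ((nat \<Rightarrow> int) \<Rightarrow> bool) \<Rightarrow> (nat \<Rightarrow> int) \<Rightarrow> bool" where
  "wp c Q R \<longleftrightarrow> (\<exists>R'. Q R' \<and> (\<forall>P i. code_at P i c \<longrightarrow>
     reach w P (time n c) (Config i R M) (Config (i + length (code c i)) R' M)))"

lemma wp_mono: "wp c Q R \<Longrightarrow> (\<And>R'. Q R' \<Longrightarrow> Q' R') \<Longrightarrow> wp c Q' R"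
  unfolding wp_def by blast

lemma wp_Skip: "Q R \<Longrightarrow> wp Skip Q R"
  unfolding wp_def by (auto intro: reach_refl)

lemma wp_InsI:
  assumes "Q R'" "\<And>P i. i < length P \<Longrightarrow> P ! i = a \<Longrightarrow>
    step w P (Config i R M) (Config (i + 1) R' M)"
  shows "wp (Ins a) Q R"
  unfolding wp_def
proof (intro exI[of _ R'] conjI allI impI assms(1))
  fix P i assume "code_at P i (Ins a)"
  then show "reach w P (time n (Ins a)) (Config i R M) (Config (i + length (code (Ins a) i)) R' M)"
    using reach_step[OF assms(2)] by (auto dest!: code_at_Ins)
qed

lemma wp_Const: "is_word w x \<Longrightarrow> Q (R(r := x)) \<Longrightarrow> wp (Ins (Const r x)) Q R"
  by (rule wp_InsI) (auto intro: step.intros simp del: One_nat_def Suc_eq_plus1 add_Suc_right)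

lemma wp_Add: "is_word w (R a + R b) \<Longrightarrow> Q (R(r := R a + R b)) \<Longrightarrow> wp (Ins (Add r a b)) Q R"
  by (rule wp_InsI) (auto intro: step.intros simp del: One_nat_def Suc_eq_plus1 add_Suc_right)

lemma wp_Mul: "is_word w (R a * R b) \<Longrightarrow> Q (R(r := R a * R b)) \<Longrightarrow> wp (Ins (Mul r a b)) Q R"
  by (rule wp_InsI) (auto intro: step.intros simp del: One_nat_def Suc_eq_plus1 add_Suc_right)

lemma wp_Load: "0 \<le> R a \<Longrightarrow> Q (R(r := M (nat (R a)))) \<Longrightarrow> wp (Ins (Load r a)) Q R"
  by (rule wp_InsI) (auto intro: step.intros simp del: One_nat_def Suc_eq_plus1 add_Suc_right)

lemma wp_Seq:
  assumes "wp c (wp d Q) R"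
  shows "wp (c ;; d) Q R"
proof -
  from assms obtain R1 R2 where "Q R2"
    and c: "\<And>P i. code_at P i c \<Longrightarrow>
      reach w P (time n c) (Config i R M) (Config (i + length (code c i)) R1 M)"
    and d: "\<And>P i. code_at P i d \<Longrightarrow>
      reach w P (time n d) (Config i R1 M) (Config (i + length (code d i)) R2 M)"
    unfolding wp_def by blast
  have "reach w P (time n (c ;; d)) (Config i R M) (Config (i + length (code (c ;; d) i)) R2 M)"
    if "code_at P i (c ;; d)" for P i
    using reach_trans[OF c[OF code_at_Seq(1)[OF that]] d[OF code_at_Seq(2)[OF that]]]
    by (simp add: add.assoc)
  with \<open>Q R2\<close> show ?thesis
    unfolding wp_def by blast
qed

lemma wp_When:
  assumes "R a \<le> R b \<Longrightarrow> wp c Q R" and "\<not> R a \<le> R b \<Longrightarrow> Q R"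
  shows "wp (When a b c) Q R"
proof (cases "R a \<le> R b")
  case True
  with assms obtain R1 where "Q R1"
    and c: "\<And>P i. code_at P i c \<Longrightarrow>
      reach w P (time n c) (Config i R M) (Config (i + length (code c i)) R1 M)"
    unfolding wp_def by blast
  have "reach w P (time n (When a b c)) (Config i R M)
          (Config (i + length (code (When a b c) i)) R1 M)"
    if at: "code_at P i (When a b c)" for P i
  proof -
    have "step w P (Config i R M) (Config (if R a \<le> R b then i + 2 else i + 1) R M)"
      using code_at_When[OF at] by (intro step.JumpLe) auto
    then have "step w P (Config i R M) (Config (i + 2) R M)"
      using True by simp
    from reach_trans[OF reach_step[OF this] c[OF code_at_When(4)[OF at]]]
    have "reach w P (1 + time n c) (Config i R M) (Config (i + length (code (When a b c) i)) R1 M)"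
      by simp
    then show ?thesis
      by (rule reach_mono) simp
  qed
  with \<open>Q R1\<close> show ?thesis
    unfolding wp_def by blast
next
  case False
  have "reach w P (time n (When a b c)) (Config i R M)
          (Config (i + length (code (When a b c) i)) R M)"
    if at: "code_at P i (When a b c)" for P i
  proof -
    have 1: "step w P (Config i R M) (Config (if R a \<le> R b then i + 2 else i + 1) R M)"
      using code_at_When[OF at] by (intro step.JumpLe) auto
    have 2: "step w P (Config (i + 1) R M)
        (Config (if R 0 \<le> R 0 then i + 2 + length (code c (i + 2)) else i + 1 + 1) R M)"
      using code_at_When[OF at] by (intro step.JumpLe) auto
    have "reach w P (1 + 1) (Config i R M) (Config (i + 2 + length (code c (i + 2))) R M)"
      using reach_trans[OF reach_step[OF 1[simplified False if_False]]
        reach_step[OF 2[simplified order_refl if_True]]] by simp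
    then show ?thesis
      by (auto elim: reach_mono simp: add_ac)
  qed
  with False assms(2) show ?thesis
    unfolding wp_def by blast
qed

text \<open>\<open>Inv v\<close> describes the state at the exit test, with \<open>v\<close> already
  in the counter. As \<open>v \<le> n\<close> there, the test \<open>R 0 \<le> R x\<close> succeeds
  exactly for \<open>v = n\<close>. The body has to hand back the counter and the 1 in register 3,
  because the increment reads both.\<close>

lemma wp_For:
  assumes "is_word w (int n)" and R: "Inv 0 (R(x := 0))"
    and inv: "\<And>v R. Inv v R \<Longrightarrow> v \<le> n \<Longrightarrow> R x = int v \<and> R 0 = int n"
    and body: "\<And>v R. Inv v R \<Longrightarrow> v < n \<Longrightarrow>
      wp c (\<lambda>R'. R' x = int v \<and> R' 3 = 1 \<and> Inv (Suc v) (R'(x := int (Suc v)))) R"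
    and Q: "\<And>R. Inv n R \<Longrightarrow> Q R"
  shows "wp (For x c) Q R"
proof -
  define j where "j = (\<lambda>i. i + 2 + length (code c (i + 2)))"
  \<comment> \<open>Induction on the number \<open>n - v\<close> of remaining rounds; the extra 1 is
    the final exit test.\<close>
  have *: "\<exists>R'. Q R' \<and> (\<forall>P i. code_at P i (For x c) \<longrightarrow>
      reach w P ((n - v) * (time n c + 3) + 1) (Config (i + 1) R M) (Config (j i + 2) R' M))"
    if "Inv v R" "v \<le> n" for v R
    using that
  proof (induction "n - v" arbitrary: v R)
    case 0
    then have Rx: "R x = int n" "R 0 = int n" and vn: "v = n"
      using inv[of v R] by auto
    have "step w P (Config (i + 1) R M) (Config (if R 0 \<le> R x then j i + 2 else i + 1 + 1) R M)"
      if at: "code_at P i (For x c)" for P i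
      using code_at_For[OF at] by (intro step.JumpLe) (auto simp: j_def)
    then show ?case
      using 0 Q[of R] vn Rx by (auto intro!: exI[of _ R] reach_step[unfolded One_nat_def])
  next
    case (Suc m)
    then have v: "v < n" by auto
    then have Rx: "R x = int v" "R 0 = int n"
      using inv[of v R] Suc by auto
    from body[OF \<open>Inv v R\<close> v] obtain R1 where R1: "R1 x = int v" "R1 3 = 1"
      "Inv (Suc v) (R1(x := int (Suc v)))"
      and c: "\<And>P i. code_at P i c \<Longrightarrow>
        reach w P (time n c) (Config i R M) (Config (i + length (code c i)) R1 M)"
      unfolding wp_def by blast
    have "m = n - Suc v" "Suc v \<le> n"
      using Suc(2) v by auto
    from Suc(1)[OF this(1) R1(3) this(2)] obtain R2 where "Q R2"
      and rest: "\<And>P i. code_at P i (For x c) \<Longrightarrow>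
        reach w P ((n - Suc v) * (time n c + 3) + 1) (Config (i + 1) (R1(x := int (Suc v))) M)
          (Config (j i + 2) R2 M)"
      by blast
    have "reach w P ((n - v) * (time n c + 3) + 1) (Config (i + 1) R M) (Config (j i + 2) R2 M)"
      if at: "code_at P i (For x c)" for P i
    proof -
      note at' = code_at_For[OF at, folded j_def]
      have "step w P (Config (i + 1) R M) (Config (if R 0 \<le> R x then j i + 2 else i + 1 + 1) R M)"
        using at' by (intro step.JumpLe) (auto simp: j_def)
      with Rx v have 1: "step w P (Config (i + 1) R M) (Config (i + 2) R M)" by simp
      have 2: "reach w P (time n c) (Config (i + 2) R M) (Config (j i) R1 M)"
        using c[OF code_at_For(6)[OF at]] by (simp add: j_def)
      have "is_word w (R1 x + R1 3)"
        using v assms(1) R1 unfolding is_word_def by linarith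
      then have "step w P (Config (j i) R1 M) (Config (j i + 1) (R1(x := R1 x + R1 3)) M)"
        using at' by (intro step.Add) (auto simp: j_def)
      with R1 have 3: "step w P (Config (j i) R1 M) (Config (j i + 1) (R1(x := int (Suc v))) M)"
        by (simp add: add.commute)
      let ?R = "R1(x := int (Suc v))"
      have 4: "step w P (Config (j i + 1) ?R M)
          (Config (if ?R 0 \<le> ?R 0 then i + 1 else j i + 1 + 1) ?R M)"
        using at' by (intro step.JumpLe) (auto simp: j_def)
      have "reach w P (1 + time n c + 1 + 1 + ((n - Suc v) * (time n c + 3) + 1))
          (Config (i + 1) R M) (Config (j i + 2) R2 M)"
        using reach_trans[OF reach_trans[OF reach_trans[OF reach_trans[OF reach_step[OF 1] 2]
          reach_step[OF 3]] reach_step[OF 4[simplified order_refl if_True]]] rest[OF at]] .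
      moreover have "n - v = Suc (n - Suc v)" using v by simp
      then have "1 + time n c + 1 + 1 + ((n - Suc v) * (time n c + 3) + 1)
          = (n - v) * (time n c + 3) + 1" by simp
      ultimately show ?thesis by (simp only:)
    qed
    with \<open>Q R2\<close> show ?case by blast
  qed
  from *[OF R] obtain R' where "Q R'" and
    loop: "\<And>P i. code_at P i (For x c) \<Longrightarrow>
      reach w P (n * (time n c + 3) + 1) (Config (i + 1) (R(x := 0)) M) (Config (j i + 2) R' M)"
    by auto
  have "reach w P (time n (For x c)) (Config i R M) (Config (i + length (code (For x c) i)) R' M)"
    if at: "code_at P i (For x c)" for P i
  proof -
    have "step w P (Config i R M) (Config (i + 1) (R(x := 0)) M)"
      using code_at_For[OF at] by (intro step.Const) (auto simp: is_word_def)
    from reach_trans[OF reach_step[OF this] loop[OF at]] show ?thesis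
      by (simp add: j_def add_ac)
  qed
  with \<open>Q R'\<close> show ?thesis
    unfolding wp_def by blast
qed

end

section \<open>Registers and the basic relaxation step\<close>

text \<open>Register 0 holds \<open>n\<close>, registers 2 and 3 hold 0 and 1, registers 4 to 6 are scratch.  The
  registers \<open>nreg i\<close> hold host vertices; \<open>freg p\<close> and \<open>vreg p\<close> are the flag and the value of an
  optional integer, pair 0 being the running optimum and pair 1 an accumulator.\<close>

definition nreg :: "nat \<Rightarrow> nat" where "nreg i = 7 + 3 * i"
definition freg :: "nat \<Rightarrow> nat" where "freg p = 8 + 3 * p"
definition vreg :: "nat \<Rightarrow> nat" where "vreg p = 9 + 3 * p"

lemma reg_distinct [simp]:
  "nreg i = nreg j \<longleftrightarrow> i = j" "freg i = freg j \<longleftrightarrow> i = j" "vreg i = vreg j \<longleftrightarrow> i = j"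
  "nreg i \<noteq> freg j" "nreg i \<noteq> vreg j" "freg i \<noteq> vreg j"
  "freg i \<noteq> nreg j" "vreg i \<noteq> nreg j" "vreg i \<noteq> freg j"
  unfolding nreg_def freg_def vreg_def by presburger+

lemma reg_small [simp]:
  "r < 7 \<Longrightarrow> nreg i \<noteq> r" "r < 7 \<Longrightarrow> freg i \<noteq> r" "r < 7 \<Longrightarrow> vreg i \<noteq> r"
  "r < 7 \<Longrightarrow> r \<noteq> nreg i" "r < 7 \<Longrightarrow> r \<noteq> freg i" "r < 7 \<Longrightarrow> r \<noteq> vreg i"
  by (simp_all add: nreg_def freg_def vreg_def)

text \<open>Atoms of a candidate: each combines a condition on images of pattern vertices with a
  weight, possibly trivial. The part on \<open>U\<close> and the offer of a host vertex to one
  element of \<open>I\<close> are thus evaluated by the same code.\<close>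

datatype summand = Node nat | Neq nat nat | Edge nat nat

text \<open>For an edge, register 4 reaches the address \<open>n + x * n + y\<close> of the
  adjacency bit and then, \<open>n * n\<close> cells further, that of the weight. Multiplying the
  flag by the bit is a conjunction without a branch.\<close>

fun summand_code :: "summand \<Rightarrow> com" where
  "summand_code (Node i) = Ins (Load 4 (nreg i)) ;; Ins (Add (vreg 1) (vreg 1) 4)"
| "summand_code (Neq i j) =
     When (nreg i) (nreg j) (When (nreg j) (nreg i) (Ins (Const (freg 1) 0)))"
| "summand_code (Edge i j) =
     Ins (Mul 4 (nreg i) 0) ;; Ins (Add 4 4 (nreg j)) ;; Ins (Add 4 4 0) ;; Ins (Load 5 4) ;;
     Ins (Mul (freg 1) (freg 1) 5) ;; Ins (Mul 6 0 0) ;; Ins (Add 4 4 6) ;; Ins (Load 5 4) ;;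
     Ins (Add (vreg 1) (vreg 1) 5)"

fun indices :: "summand \<Rightarrow> nat set" where
  "indices (Node i) = {i}"
| "indices (Neq i j) = {i, j}"
| "indices (Edge i j) = {i, j}"

definition seqs :: "com list \<Rightarrow> com" where
  "seqs cs = foldr (;;) cs Skip"

definition copy :: "nat \<Rightarrow> com" where
  "copy p = Ins (Add (freg p) (freg 1) 2) ;; Ins (Add (vreg p) (vreg 1) 2)"

text \<open>The step \<open>p := min p (ts + q)\<close> on optional integers. Transitions of the
  table and updates of the running optimum are both instances of it.\<close>

definition relax :: "nat \<Rightarrow> summand list \<Rightarrow> nat \<Rightarrow> com" where
  "relax p ts q =
     Ins (Const (freg 1) 1) ;; Ins (Const (vreg 1) 0) ;; seqs (map summand_code ts) ;;
     Ins (Mul (freg 1) (freg 1) (freg q)) ;; Ins (Add (vreg 1) (vreg 1) (vreg q)) ;;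
     When 3 (freg 1) (When (freg p) 2 (copy p) ;; When (vreg 1) (vreg p) (copy p))"

text \<open>Pair \<open>p\<close> represents \<open>Min A\<close>, where flag 0 stands for the empty minimum.\<close>

definition holds :: "(nat \<Rightarrow> int) \<Rightarrow> nat \<Rightarrow> int set \<Rightarrow> bool" where
  "holds R p A \<longleftrightarrow>
     (if A = {} then R (freg p) = 0 \<and> R (vreg p) = 0
      else R (freg p) = 1 \<and> R (vreg p) \<in> A \<and> (\<forall>a\<in>A. R (vreg p) \<le> a))"

definition temp :: "nat set" where
  "temp = {4, 5, 6, freg 1, vreg 1}"

section \<open>Correctness of the relaxation step\<close>

context machine
begin

lemma wp_seqs_Nil: "Q R \<Longrightarrow> wp (seqs []) Q R"
  by (simp add: seqs_def wp_Skip)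

lemma wp_seqs_Cons: "wp c (wp (seqs cs) Q) R \<Longrightarrow> wp (seqs (c # cs)) Q R"
  by (simp add: seqs_def wp_Seq)

end

text \<open>\<open>B\<close> is a magnitude known to fit into a word. \<open>B_n\<close> makes room
  for every address and counter, \<open>B_W\<close> for any sum of \<open>K\<close> weights.\<close>

locale instance_machine = machine +
  fixes G :: "nat graph" and nw :: "nat \<Rightarrow> int" and ew :: "nat set \<Rightarrow> int" and W K :: nat
    and B :: int
  assumes mem: "M = input_mem n G nw ew"
    and graph: "simple_graph G" "verts G = {..<n}"
    and nw_bound: "v < n \<Longrightarrow> \<bar>nw v\<bar> \<le> int W"
    and ew_bound: "e \<in> edges G \<Longrightarrow> \<bar>ew e\<bar> \<le> int W"
    and word: "\<bar>x\<bar> \<le> B \<Longrightarrow> is_word w x"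
    and B_n: "int (2 * n * n + 2 * n + 2) \<le> B"
    and B_W: "int (K * W) \<le> B"
begin

fun valid :: "(nat \<Rightarrow> nat) \<Rightarrow> summand \<Rightarrow> bool" where
  "valid \<rho> (Node i) = True"
| "valid \<rho> (Neq i j) = (\<rho> i \<noteq> \<rho> j)"
| "valid \<rho> (Edge i j) = ({\<rho> i, \<rho> j} \<in> edges G)"

text \<open>A missing edge costs 0 because its weight cell contains 0. The accumulator is thus
  determined, and bounded, for invalid candidates as well.\<close>

fun cost :: "(nat \<Rightarrow> nat) \<Rightarrow> summand \<Rightarrow> int" where
  "cost \<rho> (Node i) = nw (\<rho> i)"
| "cost \<rho> (Neq i j) = 0"
| "cost \<rho> (Edge i j) = (if {\<rho> i, \<rho> j} \<in> edges G then ew {\<rho> i, \<rho> j} else 0)"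

lemma cost_bound: "(\<And>i. i \<in> indices t \<Longrightarrow> \<rho> i < n) \<Longrightarrow> \<bar>cost \<rho> t\<bar> \<le> int W"
  by (cases t) (auto intro: nw_bound ew_bound)

abbreviation total :: "(nat \<Rightarrow> nat) \<Rightarrow> summand list \<Rightarrow> int" where
  "total \<rho> ts \<equiv> sum_list (map (cost \<rho>) ts)"

abbreviation all_valid :: "(nat \<Rightarrow> nat) \<Rightarrow> summand list \<Rightarrow> bool" where
  "all_valid \<rho> ts \<equiv> \<forall>t\<in>set ts. valid \<rho> t"

definition assigned :: "(nat \<Rightarrow> nat) \<Rightarrow> nat set \<Rightarrow> (nat \<Rightarrow> int) \<Rightarrow> bool" where
  "assigned \<rho> J R \<longleftrightarrow> R 0 = int n \<and> R 2 = 0 \<and> R 3 = 1 \<and> (\<forall>i\<in>J. R (nreg i) = int (\<rho> i) \<and> \<rho> i < n)"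

lemma total_bound:
  "(\<And>t i. t \<in> set ts \<Longrightarrow> i \<in> indices t \<Longrightarrow> \<rho> i < n) \<Longrightarrow> \<bar>total \<rho> ts\<bar> \<le> int (length ts * W)"
proof (induction ts)
  case (Cons t ts)
  have "\<bar>cost \<rho> t\<bar> \<le> int W"
    by (rule cost_bound) (use Cons.prems in auto)
  moreover have "\<bar>total \<rho> ts\<bar> \<le> int (length ts * W)"
    by (rule Cons.IH) (use Cons.prems in auto)
  ultimately show ?case by (simp add: distrib_right)
qed simp

lemma word_small: "\<bar>x\<bar> \<le> int (2 * n * n + 2 * n + 2) \<Longrightarrow> is_word w x"
  using word B_n by simp

lemma word_nat: "m \<le> 2 * n * n + 2 * n + 2 \<Longrightarrow> is_word w (int m)"
  by (rule word_small) (simp only: abs_of_nat of_nat_le_iff)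

lemma word_weight: "\<bar>x\<bar> \<le> int (K * W) \<Longrightarrow> is_word w x"
  using word B_W by simp

lemma mem_node: "x < n \<Longrightarrow> M x = nw x"
  by (simp add: mem input_mem_def)

lemma cell_less: "x < n \<Longrightarrow> y < n \<Longrightarrow> x * n + y < n * (n::nat)"
proof -
  assume "x < n" "y < n"
  then have "x * n + y < (x + 1) * n" "(x + 1) * n \<le> n * n"
    using mult_le_mono1[of "x + 1" n n] by simp_all
  then show ?thesis by linarith
qed

lemma mem_adj:
  assumes "x < n" "y < n"
  shows "M (x * n + y + n) = of_bool ({x, y} \<in> edges G)"
  using assms cell_less[OF assms] by (simp add: mem input_mem_def)

lemma mem_weight:
  assumes "x < n" "y < n"
  shows "M (x * n + y + n + n * n) = (if {x, y} \<in> edges G then ew {x, y} else 0)"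
  using assms cell_less[OF assms] by (simp add: mem input_mem_def)

text \<open>The postcondition is arbitrary and the effect of the code appears in the hypothesis on
  \<open>Q\<close>; rules of this shape chain through \<open>wp_Seq\<close>.\<close>

lemma wp_summand:
  assumes R: "assigned \<rho> (indices t) R" "R (freg 1) = of_bool b" "R (vreg 1) = z"
    and z: "\<bar>z + cost \<rho> t\<bar> \<le> int (K * W)"
    and Q: "\<And>R'. (\<And>r. r \<notin> temp \<Longrightarrow> R' r = R r) \<Longrightarrow> R' (freg 1) = of_bool (b \<and> valid \<rho> t) \<Longrightarrow>
      R' (vreg 1) = z + cost \<rho> t \<Longrightarrow> Q R'"
  shows "wp (summand_code t) Q R"
proof (cases t)
  case (Node i)
  with R have "R (nreg i) = int (\<rho> i)" "\<rho> i < n" by (auto simp: assigned_def)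
  with Node R z show ?thesis
    by (auto simp: mem_node temp_def intro!: wp_Seq wp_Load wp_Add word_weight Q)
next
  case (Neq i j)
  with R have "R (nreg i) = int (\<rho> i)" "R (nreg j) = int (\<rho> j)" by (auto simp: assigned_def)
  with Neq R z show ?thesis
    by (auto simp: temp_def intro!: wp_When wp_Const word_small Q)
next
  case (Edge i j)
  let ?x = "\<rho> i" and ?y = "\<rho> j"
  from Edge R have xy: "R (nreg i) = int ?x" "R (nreg j) = int ?y" "?x < n" "?y < n"
    and R0: "R 0 = int n"
    by (auto simp: assigned_def)
  note less = cell_less[OF xy(3,4)]
  have w: "is_word w (int (?x * n))" "is_word w (int (?x * n + ?y))" "is_word w (int (?x * n + ?y + n))"
    "is_word w (int (n * n))" "is_word w (int (?x * n + ?y + n + n * n))"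
    by (intro word_nat; use less in linarith)+
  define e where "e = cost \<rho> t"
  have mm: "M (nat (int ?x * int n + int ?y + int n)) = of_bool (valid \<rho> t)"
    "M (nat (int ?x * int n + int ?y + int n + int n * int n)) = e"
    using mem_adj[OF xy(3,4)] mem_weight[OF xy(3,4)]
    by (simp_all add: Edge e_def flip: of_nat_mult of_nat_add)
  have wb: "is_word w (of_bool P)" for P by (rule word_small) auto
  have we: "is_word w (z + e)"
    using z unfolding e_def by (rule word_weight)
  note R' = R(2,3)[simplified]
  show ?thesis
    unfolding Edge summand_code.simps
    apply (intro wp_Seq wp_Load wp_Add wp_Mul)
    using w we mm wb[of "b \<and> valid \<rho> t"]
             apply (simp_all add: xy R0 R' of_bool_conj)
    apply (intro conjI impI; rule Q; simp add: temp_def e_def R')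
    done
qed

end

lemma temp_simps [simp]: "r < 4 \<Longrightarrow> r \<notin> temp" "nreg i \<notin> temp"
  "freg p \<in> temp \<longleftrightarrow> p = 1" "vreg p \<in> temp \<longleftrightarrow> p = 1"
  by (auto simp: temp_def)

lemma holds_cong: "R' (freg p) = R (freg p) \<Longrightarrow> R' (vreg p) = R (vreg p) \<Longrightarrow> holds R' p A \<longleftrightarrow> holds R p A"
  by (simp add: holds_def)

context instance_machine
begin

lemma assigned_cong:
  assumes "assigned \<rho> J R" "R' 0 = R 0" "R' 2 = R 2" "R' 3 = R 3" "\<And>i. R' (nreg i) = R (nreg i)"
  shows "assigned \<rho> J R'"
  using assms by (simp add: assigned_def)

lemma assigned_subset: "assigned \<rho> J R \<Longrightarrow> J' \<subseteq> J \<Longrightarrow> assigned \<rho> J' R"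
  by (auto simp: assigned_def)

lemma wp_summands:
  assumes "assigned \<rho> (\<Union> (indices ` set ts)) R" "R (freg 1) = of_bool b" "R (vreg 1) = z"
    and "\<bar>z\<bar> + int (length ts * W) \<le> int (K * W)"
    and "\<And>R'. (\<And>r. r \<notin> temp \<Longrightarrow> R' r = R r) \<Longrightarrow> R' (freg 1) = of_bool (b \<and> all_valid \<rho> ts) \<Longrightarrow>
      R' (vreg 1) = z + total \<rho> ts \<Longrightarrow> Q R'"
  shows "wp (seqs (map summand_code ts)) Q R"
  using assms
proof (induction ts arbitrary: R b z)
  case Nil
  then show ?case by (simp add: wp_seqs_Nil)
next
  case (Cons t ts)
  have t: "\<bar>cost \<rho> t\<bar> \<le> int W"
    by (rule cost_bound) (use Cons.prems(1) in \<open>auto simp: assigned_def\<close>)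
  have len: "int (length (t # ts) * W) = int (length ts * W) + int W"
    by simp
  \<comment> \<open>The budget \<open>K * W\<close> is shared: each finished summand moves at most
    \<open>W\<close> from the reserve for the remaining ones into the partial sum.\<close>
  have z: "\<bar>z + cost \<rho> t\<bar> + int (length ts * W) \<le> int (K * W)"
    using t Cons.prems(4) unfolding len by linarith
  have "wp (summand_code t) (wp (seqs (map summand_code ts)) Q) R"
  proof (rule wp_summand[OF _ Cons.prems(2,3)])
    show "assigned \<rho> (indices t) R"
      using Cons.prems(1) by (rule assigned_subset) auto
    show "\<bar>z + cost \<rho> t\<bar> \<le> int (K * W)"
      using z by linarith
    fix R1 assume R1: "\<And>r. r \<notin> temp \<Longrightarrow> R1 r = R r"
      "R1 (freg 1) = of_bool (b \<and> valid \<rho> t)" "R1 (vreg 1) = z + cost \<rho> t"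
    show "wp (seqs (map summand_code ts)) Q R1"
    proof (rule Cons.IH[OF _ R1(2,3) z])
      show "assigned \<rho> (\<Union> (indices ` set ts)) R1"
        using assigned_subset[OF Cons.prems(1)] by (rule assigned_cong) (auto simp: R1(1))
      fix R' assume "\<And>r. r \<notin> temp \<Longrightarrow> R' r = R1 r"
        "R' (freg 1) = of_bool ((b \<and> valid \<rho> t) \<and> all_valid \<rho> ts)"
        "R' (vreg 1) = z + cost \<rho> t + total \<rho> ts"
      with R1(1) show "Q R'"
        by (intro Cons.prems(5)) (auto simp: add.assoc)
    qed
  qed
  then show ?case by (simp add: wp_seqs_Cons)
qed

definition extend :: "(nat \<Rightarrow> nat) \<Rightarrow> summand list \<Rightarrow> int set \<Rightarrow> int set" where
  "extend \<rho> ts A = {total \<rho> ts + a |a. a \<in> A \<and> all_valid \<rho> ts}"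

text \<open>Adding the constant \<open>total \<rho> ts\<close> commutes with taking a minimum, so
  the minimum over \<open>C\<close> is all that is needed for the minimum over
  \<open>extend \<rho> ts C\<close>.\<close>

lemma wp_relax:
  assumes R: "assigned \<rho> (\<Union> (indices ` set ts)) R"
    and p: "holds R p A" "p \<noteq> 1" and q: "holds R q C" "q \<noteq> 1"
    and C: "\<And>a. a \<in> C \<Longrightarrow> \<bar>a\<bar> + int (length ts * W) \<le> int (K * W)"
    and ts: "int (length ts * W) \<le> int (K * W)"
    and A: "\<And>a. a \<in> A \<Longrightarrow> \<bar>a\<bar> \<le> int (K * W)"
    and Q: "\<And>R'. (\<And>r. r \<notin> temp \<Longrightarrow> r \<noteq> freg p \<Longrightarrow> r \<noteq> vreg p \<Longrightarrow> R' r = R r) \<Longrightarrow>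
      holds R' p (A \<union> extend \<rho> ts C) \<Longrightarrow> Q R'"
  shows "wp (relax p ts q) Q R"
proof -
  define v where "v = total \<rho> ts + R (vreg q)"
  define f where "f = (C \<noteq> {} \<and> all_valid \<rho> ts)"
  have R23: "R 2 = 0" "R 3 = 1"
    using R by (auto simp: assigned_def)
  have w1: "is_word w (of_bool P)" for P by (rule word_small) auto
  have "\<bar>total \<rho> ts\<bar> \<le> int (length ts * W)"
    by (rule total_bound) (use R in \<open>auto simp: assigned_def\<close>)
  \<comment> \<open>An empty pair stores the value 0, so the unconditional addition of
    \<open>vreg q\<close> cannot overflow in that case either.\<close>
  moreover have "\<bar>R (vreg q)\<bar> + int (length ts * W) \<le> int (K * W)"
    using q C ts by (auto simp: holds_def split: if_splits)
  ultimately have wv: "is_word w v"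
    unfolding v_def by (intro word_weight) linarith
  have ext: "extend \<rho> ts C = {}" if "\<not> f"
    using that by (auto simp: extend_def f_def)
  have ext': "v \<in> extend \<rho> ts C" "\<And>a. a \<in> extend \<rho> ts C \<Longrightarrow> v \<le> a" if f
    using that q by (auto simp: extend_def f_def v_def holds_def split: if_splits)
  let ?init = "R(freg 1 := 1, vreg 1 := 0)"
  have "wp (seqs (map summand_code ts)) (wp (
     Ins (Mul (freg 1) (freg 1) (freg q)) ;; Ins (Add (vreg 1) (vreg 1) (vreg q)) ;;
     When 3 (freg 1) (When (freg p) 2 (copy p) ;; When (vreg 1) (vreg p) (copy p))) Q) ?init"
  proof (rule wp_summands[where b = True and z = 0])
    show "assigned \<rho> (\<Union> (indices ` set ts)) ?init"
      using R by (rule assigned_cong) auto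
    fix R1 assume R1: "\<And>r. r \<notin> temp \<Longrightarrow> R1 r = ?init r"
      "R1 (freg 1) = of_bool (True \<and> all_valid \<rho> ts)" "R1 (vreg 1) = 0 + total \<rho> ts"
    define R2 where "R2 = R1(freg 1 := of_bool f, vreg 1 := v)"
    have f: "R1 (freg 1) * R1 (freg q) = of_bool f"
      using R1 q by (auto simp: holds_def f_def split: if_splits)
    have v: "R1 (vreg 1) + R1 (vreg q) = v"
      using R1 q by (auto simp: v_def)
    have R2: "R2 2 = 0" "R2 3 = 1" "R2 (freg 1) = of_bool f" "R2 (vreg 1) = v"
      "\<And>r. r \<notin> temp \<Longrightarrow> R2 r = R r"
      using R1(1) R23 by (auto simp: R2_def temp_def)
    have p2: "holds R2 p A"
      using p R2(5) by (subst holds_cong[of _ _ R]) auto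
    have cp: "wp (copy p) Q' R3" if "R3 2 = 0" "R3 (freg 1) = 1" "R3 (vreg 1) = v"
      "Q' (R3(freg p := 1, vreg p := v))" for Q' R3
      unfolding copy_def using that p(2) wv w1[of True]
      by (intro wp_Seq wp_Add) (auto simp del: One_nat_def)
    have "wp (When 3 (freg 1) (When (freg p) 2 (copy p) ;; When (vreg 1) (vreg p) (copy p))) Q R2"
    proof (rule wp_When)
      assume "\<not> R2 3 \<le> R2 (freg 1)"
      with R2 have "\<not> f" by (cases f) auto
      with p2 ext R2 show "Q R2"
        by (intro Q) auto
    next
      assume "R2 3 \<le> R2 (freg 1)"
      with R2 have f by (cases f) auto
      note e = ext'[OF \<open>f\<close>]
      let ?R3 = "R2(freg p := 1, vreg p := v)"
      have 1: "Q ?R3" if "A = {} \<or> v \<le> R2 (vreg p)"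
      proof (rule Q)
        show "holds ?R3 p (A \<union> extend \<rho> ts C)"
          using that e p2 by (force simp: holds_def split: if_splits)
      qed (auto simp: R2)
      have 2: "Q R2" if "A \<noteq> {}" "\<not> v \<le> R2 (vreg p)"
      proof (rule Q)
        show "holds R2 p (A \<union> extend \<rho> ts C)"
          using that e p2 by (force simp: holds_def split: if_splits)
      qed (auto simp: R2)
      \<comment> \<open>If \<open>A\<close> is empty, the first test copies; the second then
        compares \<open>v\<close> with itself and copies again without effect. Otherwise only the
        second test can fire.\<close>
      show "wp (When (freg p) 2 (copy p) ;; When (vreg 1) (vreg p) (copy p)) Q R2"
      proof (cases "A = {}")
        case True
        then have "R2 (freg p) = 0" "R2 (vreg p) = 0"
          using p2 by (auto simp: holds_def)
        then show ?thesis
          using R2 \<open>f\<close> p(2) 1 True by (intro wp_Seq wp_When cp) auto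
      next
        case False
        then have "R2 (freg p) = 1"
          using p2 by (auto simp: holds_def)
        then show ?thesis
          using R2 \<open>f\<close> p(2) 1 2 False by (intro wp_Seq wp_When cp) auto
      qed
    qed
    then have 3: "wp (When 3 (freg 1) (When (freg p) 2 (copy p) ;; When (vreg 1) (vreg p) (copy p))) Q
      (R1(freg 1 := R1 (freg 1) * R1 (freg q), vreg 1 := R1 (vreg 1) + R1 (vreg q)))"
      unfolding R2_def f v .
    show "wp (Ins (Mul (freg 1) (freg 1) (freg q)) ;; Ins (Add (vreg 1) (vreg 1) (vreg q)) ;;
     When 3 (freg 1) (When (freg p) 2 (copy p) ;; When (vreg 1) (vreg p) (copy p))) Q R1"
      apply (intro wp_Seq wp_Mul wp_Add)
      using 3 f v w1[of f] wv by (simp_all del: One_nat_def)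
  qed (use ts in auto)
  then show ?thesis
    unfolding relax_def using w1[of True] w1[of False]
    by (intro wp_Seq[of "Ins _"] wp_Const wp_Seq[of "seqs _"]) simp_all
qed

end

section \<open>Assignments of the independent set by dynamic programming\<close>

definition matchings ::
  "('a \<Rightarrow> nat \<Rightarrow> int) \<Rightarrow> ('a \<Rightarrow> nat \<Rightarrow> bool) \<Rightarrow> nat \<Rightarrow> 'a set \<Rightarrow> int set" where
  "matchings c ok v S =
     {\<Sum>i\<in>S. c i (q i) |q. inj_on q S \<and> (\<forall>i\<in>S. q i < v \<and> ok i (q i))}"

lemma matchings_0: "matchings c ok 0 S = (if S = {} then {0} else {})"
  by (auto simp: matchings_def)

text \<open>The recurrence distinguishes which element of \<open>S\<close>, if any, is matched to the new vertex \<open>v\<close>.\<close>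

lemma matchings_Suc:
  assumes "finite S"
  shows "matchings c ok (Suc v) S =
    matchings c ok v S \<union> (\<Union>i\<in>S. {c i v + a |a. a \<in> matchings c ok v (S - {i}) \<and> ok i v})"
    (is "?L = ?A \<union> ?B")
proof (intro equalityI subsetI)
  fix x assume "x \<in> ?L"
  then obtain q where q: "x = (\<Sum>i\<in>S. c i (q i))" "inj_on q S" "\<And>i. i \<in> S \<Longrightarrow> q i < Suc v \<and> ok i (q i)"
    by (auto simp: matchings_def)
  show "x \<in> ?A \<union> ?B"
  proof (cases "\<exists>i\<in>S. q i = v")
    case True
    then obtain i where i: "i \<in> S" "q i = v" by blast
    \<comment> \<open>By injectivity only \<open>i\<close> is sent to \<open>v\<close>, so the rest
      is a matching into the vertices below \<open>v\<close>.\<close>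
    have "q j < v" if "j \<in> S - {i}" for j
      using q(2) q(3)[of j] i that by (auto simp: inj_on_def less_Suc_eq)
    then have "(\<Sum>j\<in>S - {i}. c j (q j)) \<in> matchings c ok v (S - {i})"
      using q by (auto simp: matchings_def intro!: exI[of _ q] intro: inj_on_subset)
    moreover have "x = c i v + (\<Sum>j\<in>S - {i}. c j (q j))"
      using q(1) i assms by (simp add: sum.remove)
    ultimately show ?thesis
      using i q(3)[of i] by auto
  next
    case False
    then have "q i < v" if "i \<in> S" for i
      using q(3)[OF that] that by (auto simp: less_Suc_eq)
    then show ?thesis
      using q by (auto simp: matchings_def)
  qed
next
  fix x assume "x \<in> ?A \<union> ?B"
  then show "x \<in> ?L"
  proof
    assume "x \<in> ?A"
    then show ?thesis by (force simp: matchings_def)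
  next
    assume "x \<in> ?B"
    then obtain i q where i: "i \<in> S" "ok i v" "x = c i v + (\<Sum>j\<in>S - {i}. c j (q j))"
      and q: "inj_on q (S - {i})" "\<And>j. j \<in> S - {i} \<Longrightarrow> q j < v \<and> ok j (q j)"
      by (auto simp: matchings_def)
    let ?q = "q(i := v)"
    have "inj_on ?q S"
      using q i(1) by (force simp: inj_on_def)
    moreover have "x = (\<Sum>j\<in>S. c j (?q j))"
      using i assms by (simp add: sum.remove cong: sum.cong_simp)
    ultimately show ?thesis
      using i q unfolding matchings_def by (intro CollectI exI[of _ ?q]) (auto simp: less_Suc_eq)
  qed
qed

lemma set_decode_subset: "c < 2 ^ s \<Longrightarrow> set_decode c \<subseteq> {..<s}"
proof
  fix x assume "c < 2 ^ s" "x \<in> set_decode c"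
  then have "c div 2 ^ x \<noteq> 0"
    by (auto simp: set_decode_def intro!: Nat.gr0I)
  then have "2 ^ x \<le> c"
    by (meson div_less not_le)
  then have "(2::nat) ^ x < 2 ^ s"
    using \<open>c < 2 ^ s\<close> by (rule le_less_trans)
  then show "x \<in> {..<s}" by simp
qed

lemma set_encode_remove_less:
  assumes "i \<in> set_decode c"
  shows "set_encode (set_decode c - {i}) < c"
proof -
  have "set_encode (set_decode c) = 2 ^ i + set_encode (set_decode c - {i})"
    unfolding set_encode_def using assms by (simp add: sum.remove)
  moreover have "(0::nat) < 2 ^ i" by simp
  ultimately show ?thesis unfolding set_decode_inverse by linarith
qed

lemma set_encode_lessThan: "set_encode {..<s} < 2 ^ s"
  unfolding set_encode_def lessThan_atLeast0 by (simp add: sum_power2)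

text \<open>The pattern has vertices \<open>0, \<dots>, k - 1\<close> with adjacency \<open>a\<close>, and \<open>0, \<dots>, s - 1\<close> are independent.
  Register \<open>nreg k\<close> holds the host vertex currently offered to the independent vertices.\<close>

definition match_summands :: "nat \<Rightarrow> nat \<Rightarrow> (nat \<Rightarrow> nat \<Rightarrow> bool) \<Rightarrow> nat \<Rightarrow> summand list" where
  "match_summands k s a i =
     Node k # map (Neq k) [s..<k] @ map (Edge k) (filter (a i) [s..<k])"

text \<open>Only pairs \<open>i < j\<close> are listed, so every pattern edge inside
  \<open>{s..<k}\<close> is paid once. Edges at the independent vertices are left to
  \<open>match_summands\<close>.\<close>

definition base_summands :: "nat \<Rightarrow> nat \<Rightarrow> (nat \<Rightarrow> nat \<Rightarrow> bool) \<Rightarrow> summand list" where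
  "base_summands k s a = map Node [s..<k] @
     concat (map (\<lambda>i. map (Neq i) [Suc i..<k] @ map (Edge i) (filter (a i) [Suc i..<k])) [s..<k])"

text \<open>The table entry of \<open>S \<subseteq> {..<s}\<close> is pair \<open>2 + set_encode S\<close>.  Since removing an element decreases
  \<open>set_encode\<close>, processing the codes in descending order updates the table in place.\<close>

definition dp_row :: "nat \<Rightarrow> nat \<Rightarrow> (nat \<Rightarrow> nat \<Rightarrow> bool) \<Rightarrow> nat \<Rightarrow> com" where
  "dp_row k s a c =
     seqs (map (\<lambda>i. relax (2 + c) (match_summands k s a i) (2 + set_encode (set_decode c - {i})))
       (sorted_list_of_set (set_decode c)))"

definition dp_step :: "nat \<Rightarrow> nat \<Rightarrow> (nat \<Rightarrow> nat \<Rightarrow> bool) \<Rightarrow> com" where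
  "dp_step k s a = seqs (map (dp_row k s a) (rev [0..<2 ^ s]))"

text \<open>Before any host vertex has been offered, only the empty set can be matched, at cost
  0.\<close>

definition dp_init :: "nat \<Rightarrow> com" where
  "dp_init C = seqs (map (\<lambda>c. Ins (Const (freg (2 + c)) (of_bool (c = 0))) ;;
     Ins (Const (vreg (2 + c)) 0)) [0..<C])"

definition search :: "nat \<Rightarrow> nat \<Rightarrow> (nat \<Rightarrow> nat \<Rightarrow> bool) \<Rightarrow> com" where
  "search k s a = dp_init (2 ^ s) ;; For (nreg k) (dp_step k s a) ;;
     relax 0 (base_summands k s a) (2 + set_encode {..<s})"

definition nest :: "nat list \<Rightarrow> com \<Rightarrow> com" where
  "nest js c = foldr (\<lambda>j. For (nreg j)) js c"

text \<open>Registers start at 0, which already makes pair 0 the empty minimum. Register 2 keeps its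
  0 throughout, so adding it copies a register.\<close>

definition program :: "nat \<Rightarrow> nat \<Rightarrow> (nat \<Rightarrow> nat \<Rightarrow> bool) \<Rightarrow> com" where
  "program k s a = Ins (Const 3 1) ;; nest [s..<k] (search k s a) ;;
     Ins (Add 1 (vreg 0) 2) ;; Ins (Add 0 (freg 0) 2)"

definition frame :: "(nat \<Rightarrow> int) \<Rightarrow> (nat \<Rightarrow> int) \<Rightarrow> bool" where
  "frame R R' \<longleftrightarrow> (\<forall>r \<in> {0, 2, 3, freg 0, vreg 0} \<union> range nreg. R' r = R r)"

lemma frame_trans: "frame R R' \<Longrightarrow> frame R' R'' \<Longrightarrow> frame R R''"
  by (simp add: frame_def)

lemma frame_refl: "frame R R"
  by (simp add: frame_def)

section \<open>Correctness of the table updates\<close>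

locale copy_machine = instance_machine +
  fixes k s :: nat and a :: "nat \<Rightarrow> nat \<Rightarrow> bool"
  assumes s_le: "s \<le> k"
    and K: "K = (s + 1) * (2 * k + 1) + length (base_summands k s a)"
begin

abbreviation "U \<equiv> {s..<k}"

definition match_cost :: "(nat \<Rightarrow> nat) \<Rightarrow> nat \<Rightarrow> nat \<Rightarrow> int" where
  "match_cost \<rho> i v = total (\<rho>(k := v)) (match_summands k s a i)"

definition match_ok :: "(nat \<Rightarrow> nat) \<Rightarrow> nat \<Rightarrow> nat \<Rightarrow> bool" where
  "match_ok \<rho> i v \<longleftrightarrow> all_valid (\<rho>(k := v)) (match_summands k s a i)"

abbreviation table :: "(nat \<Rightarrow> nat) \<Rightarrow> nat \<Rightarrow> nat set \<Rightarrow> int set" where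
  "table \<rho> \<equiv> matchings (match_cost \<rho>) (match_ok \<rho>)"

lemma assigned_frame: "assigned \<rho> J R \<Longrightarrow> frame R R' \<Longrightarrow> assigned \<rho> J R'"
  by (rule assigned_cong) (auto simp: frame_def)

lemma holds_frame: "holds R 0 A \<Longrightarrow> frame R R' \<Longrightarrow> holds R' 0 A"
  by (subst holds_cong[of _ _ R]) (auto simp: frame_def)

lemma match_indices: "t \<in> set (match_summands k s a i) \<Longrightarrow> indices t \<subseteq> insert k U"
  by (auto simp: match_summands_def)

lemma length_match: "length (match_summands k s a i) \<le> 2 * k + 1"
  using length_filter_le[of "a i" "[s..<k]"] s_le by (simp add: match_summands_def)

lemma length_match_W: "int (length (match_summands k s a i) * W) \<le> int ((2 * k + 1) * W)"
  using length_match[of i] by (simp only: of_nat_le_iff mult_le_mono1)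

lemma match_cost_bound:
  assumes "\<forall>j\<in>U. \<rho> j < n" "v < n"
  shows "\<bar>match_cost \<rho> i v\<bar> \<le> int ((2 * k + 1) * W)"
proof -
  have "\<bar>match_cost \<rho> i v\<bar> \<le> int (length (match_summands k s a i) * W)"
    unfolding match_cost_def
  proof (rule total_bound)
    fix t j assume "t \<in> set (match_summands k s a i)" "j \<in> indices t"
    then have "j \<in> insert k U"
      using match_indices by blast
    then show "(\<rho>(k := v)) j < n"
      using assms by auto
  qed
  with length_match_W[of i] show ?thesis by linarith
qed

lemma table_bound:
  assumes "\<forall>j\<in>U. \<rho> j < n" "v \<le> n" "x \<in> table \<rho> v S" "S \<subseteq> {..<s}"
  shows "\<bar>x\<bar> \<le> int (s * (2 * k + 1) * W)"
proof -
  from assms(3) obtain q where q: "x = (\<Sum>i\<in>S. match_cost \<rho> i (q i))" "\<And>i. i \<in> S \<Longrightarrow> q i < v"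
    by (auto simp: matchings_def)
  have "\<bar>x\<bar> \<le> (\<Sum>i\<in>S. \<bar>match_cost \<rho> i (q i)\<bar>)"
    unfolding q(1) by (rule sum_abs)
  also have "\<dots> \<le> (\<Sum>i\<in>S. int ((2 * k + 1) * W))"
    using q(2) assms(2) by (intro sum_mono match_cost_bound assms(1)) (auto dest: less_le_trans)
  also have "\<dots> = int (card S * ((2 * k + 1) * W))" by simp
  also have "card S \<le> s"
    using card_mono[OF _ assms(4)] by simp
  then have "int (card S * ((2 * k + 1) * W)) \<le> int (s * ((2 * k + 1) * W))"
    by (simp only: of_nat_le_iff mult_le_mono1)
  finally show ?thesis by (simp only: mult.assoc)
qed

text \<open>The origin of \<open>K\<close>: a table entry collects at most \<open>s\<close> matched
  vertices with at most \<open>2 * k + 1\<close> summands each, one more vertex may be in the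
  accumulator, and the part on \<open>U\<close> is added at the end.\<close>

lemma K_W: "int (K * W) = int (s * (2 * k + 1) * W) + int ((2 * k + 1) * W)
    + int (length (base_summands k s a) * W)"
  unfolding K by (simp add: algebra_simps)

lemma extend_match: "extend (\<rho>(k := v)) (match_summands k s a i) A =
    {match_cost \<rho> i v + x |x. x \<in> A \<and> match_ok \<rho> i v}"
  by (simp add: extend_def match_cost_def match_ok_def)

text \<open>Generalised to a list \<open>xs\<close> of choices still to be tried and a set
  \<open>A\<close> of costs collected so far. The sources \<open>set_decode c - {i}\<close> have
  codes below \<open>c\<close>, and those entries still belong to \<open>v\<close>.\<close>

lemma wp_dp_row_list:
  assumes "assigned (\<rho>(k := v)) (insert k U) R" and "c < 2 ^ s" and "set xs \<subseteq> set_decode c"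
    and "\<And>e. e < c \<Longrightarrow> holds R (2 + e) (table \<rho> v (set_decode e))"
    and "holds R (2 + c) A" and "\<And>x. x \<in> A \<Longrightarrow> \<bar>x\<bar> \<le> int (K * W)"
    and "\<And>R'. (\<And>r. r \<notin> temp \<Longrightarrow> r \<noteq> freg (2 + c) \<Longrightarrow> r \<noteq> vreg (2 + c) \<Longrightarrow> R' r = R r) \<Longrightarrow>
      holds R' (2 + c) (A \<union> (\<Union>i\<in>set xs. {match_cost \<rho> i v + x |x.
        x \<in> table \<rho> v (set_decode c - {i}) \<and> match_ok \<rho> i v})) \<Longrightarrow> Q R'"
  shows "wp (seqs (map (\<lambda>i. relax (2 + c) (match_summands k s a i)
    (2 + set_encode (set_decode c - {i}))) xs)) Q R"
  using assms
proof (induction xs arbitrary: R A)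
  case Nil
  then show ?case by (auto intro: wp_seqs_Nil)
next
  case (Cons i xs)
  let ?S = "set_decode c - {i}"
  let ?new = "{match_cost \<rho> i v + x |x. x \<in> table \<rho> v ?S \<and> match_ok \<rho> i v}"
  have \<rho>: "\<forall>j\<in>U. \<rho> j < n" "v < n"
    using Cons.prems(1) by (auto simp: assigned_def split: if_splits)
  have e: "set_encode ?S < c" "set_decode (set_encode ?S) = ?S"
    using Cons.prems(3) by (auto intro: set_encode_remove_less)
  have S: "?S \<subseteq> {..<s}"
    using set_decode_subset[OF Cons.prems(2)] by blast
  have b: "\<bar>x\<bar> \<le> int (s * (2 * k + 1) * W)" if "x \<in> table \<rho> v ?S" for x
    using table_bound[OF \<rho>(1) _ that S] \<rho>(2) by auto
  have "wp (relax (2 + c) (match_summands k s a i) (2 + set_encode ?S))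
    (wp (seqs (map (\<lambda>i. relax (2 + c) (match_summands k s a i)
      (2 + set_encode (set_decode c - {i}))) xs)) Q) R"
  proof (rule wp_relax[where \<rho> = "\<rho>(k := v)"])
    show "assigned (\<rho>(k := v)) (\<Union> (indices ` set (match_summands k s a i))) R"
      by (rule assigned_subset[OF Cons.prems(1)]) (use match_indices in blast)
    show "holds R (2 + c) A" by fact
    show "holds R (2 + set_encode ?S) (table \<rho> v ?S)"
      using Cons.prems(4)[OF e(1)] by (simp only: e(2))
    show "\<bar>x\<bar> + int (length (match_summands k s a i) * W) \<le> int (K * W)"
      if "x \<in> table \<rho> v ?S" for x
      using b[OF that] length_match_W[of i] unfolding K_W by linarith
    show "int (length (match_summands k s a i) * W) \<le> int (K * W)"
      using length_match_W[of i] unfolding K_W by linarith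
    fix R1 assume R1: "\<And>r. r \<notin> temp \<Longrightarrow> r \<noteq> freg (2 + c) \<Longrightarrow> r \<noteq> vreg (2 + c) \<Longrightarrow> R1 r = R r"
      and h: "holds R1 (2 + c) (A \<union> extend (\<rho>(k := v)) (match_summands k s a i) (table \<rho> v ?S))"
    show "wp (seqs (map (\<lambda>i. relax (2 + c) (match_summands k s a i)
      (2 + set_encode (set_decode c - {i}))) xs)) Q R1"
    proof (rule Cons.IH[OF _ Cons.prems(2)])
      show "assigned (\<rho>(k := v)) (insert k U) R1"
        using Cons.prems(1) by (rule assigned_cong) (auto simp: R1)
      show "set xs \<subseteq> set_decode c" using Cons.prems(3) by auto
      show "holds R1 (2 + e) (table \<rho> v (set_decode e))" if "e < c" for e
        using Cons.prems(4)[OF that] that by (subst holds_cong[of _ _ R]) (auto simp: R1)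
      show "holds R1 (2 + c) (A \<union> ?new)"
        using h by (simp only: extend_match)
      show "\<bar>x\<bar> \<le> int (K * W)" if x: "x \<in> A \<union> ?new" for x
      proof -
        have "\<bar>match_cost \<rho> i v + y\<bar> \<le> int (K * W)" if "y \<in> table \<rho> v ?S" for y
          using match_cost_bound[OF \<rho>, where i = i] b[OF that] unfolding K_W by linarith
        then show ?thesis
          using x Cons.prems(6) by blast
      qed
      fix R' assume R': "\<And>r. r \<notin> temp \<Longrightarrow> r \<noteq> freg (2 + c) \<Longrightarrow> r \<noteq> vreg (2 + c) \<Longrightarrow> R' r = R1 r"
        "holds R' (2 + c) (A \<union> ?new \<union> (\<Union>i\<in>set xs. {match_cost \<rho> i v + x |x.
          x \<in> table \<rho> v (set_decode c - {i}) \<and> match_ok \<rho> i v}))"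
      show "Q R'"
      proof (rule Cons.prems(7))
        show "R' r = R r" if "r \<notin> temp" "r \<noteq> freg (2 + c)" "r \<noteq> vreg (2 + c)" for r
          using R'(1) R1 that by simp
      qed (use R'(2) in \<open>simp only: list.set UN_insert Un_assoc\<close>)
    qed
  qed (use Cons.prems in auto)
  then show ?case by (simp add: wp_seqs_Cons)
qed

lemma wp_dp_row:
  assumes R: "assigned (\<rho>(k := v)) (insert k U) R" and c: "c < 2 ^ s"
    and T: "\<And>e. e \<le> c \<Longrightarrow> holds R (2 + e) (table \<rho> v (set_decode e))"
    and Q: "\<And>R'. (\<And>r. r \<notin> temp \<Longrightarrow> r \<noteq> freg (2 + c) \<Longrightarrow> r \<noteq> vreg (2 + c) \<Longrightarrow> R' r = R r) \<Longrightarrow>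
      holds R' (2 + c) (table \<rho> (Suc v) (set_decode c)) \<Longrightarrow> Q R'"
  shows "wp (dp_row k s a c) Q R"
  unfolding dp_row_def
proof (rule wp_dp_row_list[OF R c])
  have \<rho>: "\<forall>j\<in>U. \<rho> j < n" "v < n"
    using R by (auto simp: assigned_def split: if_splits)
  show "holds R (2 + c) (table \<rho> v (set_decode c))"
    using T by simp
  show "\<bar>x\<bar> \<le> int (K * W)" if "x \<in> table \<rho> v (set_decode c)" for x
    using table_bound[OF \<rho>(1) less_imp_le[OF \<rho>(2)] that set_decode_subset[OF c]]
    unfolding K_W by linarith
  show "holds R (2 + e) (table \<rho> v (set_decode e))" if "e < c" for e
    using T that by simp
  fix R'
  assume "\<And>r. r \<notin> temp \<Longrightarrow> r \<noteq> freg (2 + c) \<Longrightarrow> r \<noteq> vreg (2 + c) \<Longrightarrow> R' r = R r"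
    and "holds R' (2 + c) (table \<rho> v (set_decode c) \<union>
      (\<Union>i\<in>set (sorted_list_of_set (set_decode c)). {match_cost \<rho> i v + x |x.
        x \<in> table \<rho> v (set_decode c - {i}) \<and> match_ok \<rho> i v}))"
  then show "Q R'"
    by (intro Q) (simp_all only: matchings_Suc[OF finite_set_decode]
      set_sorted_list_of_set[OF finite_set_decode])
qed simp

text \<open>The mixed table is the invariant of the descending sweep: codes below \<open>C\<close>
  still describe \<open>v\<close>, the others already \<open>Suc v\<close>.\<close>

lemma wp_dp_step_list:
  assumes "assigned (\<rho>(k := v)) (insert k U) R" and "C \<le> 2 ^ s"
    and "\<And>e. e < 2 ^ s \<Longrightarrow> holds R (2 + e) (table \<rho> (if e < C then v else Suc v) (set_decode e))"
    and "\<And>R'. frame R R' \<Longrightarrow>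
      (\<And>e. e < 2 ^ s \<Longrightarrow> holds R' (2 + e) (table \<rho> (Suc v) (set_decode e))) \<Longrightarrow> Q R'"
  shows "wp (seqs (map (dp_row k s a) (rev [0..<C]))) Q R"
  using assms
proof (induction C arbitrary: R)
  case 0
  then show ?case by (auto intro!: wp_seqs_Nil 0 frame_refl)
next
  case (Suc C)
  have "wp (dp_row k s a C) (wp (seqs (map (dp_row k s a) (rev [0..<C]))) Q) R"
  proof (rule wp_dp_row[OF Suc.prems(1)])
    show "holds R (2 + e) (table \<rho> v (set_decode e))" if "e \<le> C" for e
      using Suc.prems(2) Suc.prems(3)[of e] that by (simp split: if_splits)
    fix R1 assume R1: "\<And>r. r \<notin> temp \<Longrightarrow> r \<noteq> freg (2 + C) \<Longrightarrow> r \<noteq> vreg (2 + C) \<Longrightarrow> R1 r = R r"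
      and h: "holds R1 (2 + C) (table \<rho> (Suc v) (set_decode C))"
    have fr: "frame R R1"
      by (auto simp: frame_def R1)
    show "wp (seqs (map (dp_row k s a) (rev [0..<C]))) Q R1"
    proof (rule Suc.IH)
      show "holds R1 (2 + e) (table \<rho> (if e < C then v else Suc v) (set_decode e))"
        if "e < 2 ^ s" for e
      proof (cases "e = C")
        case False
        then have "holds R1 (2 + e) A \<longleftrightarrow> holds R (2 + e) A" for A
          by (intro holds_cong) (auto simp: R1)
        with False Suc.prems(3)[OF that] show ?thesis
          by (simp add: less_Suc_eq)
      qed (use h in simp)
      show "assigned (\<rho>(k := v)) (insert k U) R1"
        using Suc.prems(1) fr by (rule assigned_frame)
      show "C \<le> 2 ^ s" using Suc.prems(2) by simp
      show "Q R'" if "frame R1 R'"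
        "\<And>e. e < 2 ^ s \<Longrightarrow> holds R' (2 + e) (table \<rho> (Suc v) (set_decode e))" for R'
        using Suc.prems(4)[OF frame_trans[OF fr that(1)] that(2)] .
    qed
  qed (use Suc.prems in auto)
  then show ?case by (simp add: wp_seqs_Cons)
qed

lemma wp_dp_init:
  assumes "\<And>R'. frame R R' \<Longrightarrow>
      (\<And>e. e < C \<Longrightarrow> holds R' (2 + e) (if e = 0 then {0} else {})) \<Longrightarrow> Q R'"
  shows "wp (dp_init C) Q R"
proof -
  have w: "is_word w (of_bool P)" for P by (rule word_small) auto
  have "wp (seqs (map (\<lambda>c. Ins (Const (freg (2 + c)) (of_bool (c = 0))) ;;
      Ins (Const (vreg (2 + c)) 0)) [D..<C])) Q R"
    if "D \<le> C" "\<And>e. e < D \<Longrightarrow> holds R (2 + e) (if e = 0 then {0} else {})"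
      "\<And>R'. frame R R' \<Longrightarrow>
        (\<And>e. e < C \<Longrightarrow> holds R' (2 + e) (if e = 0 then {0} else {})) \<Longrightarrow> Q R'" for D
    using that
  proof (induction "C - D" arbitrary: D R)
    case 0
    then show ?case by (auto intro!: wp_seqs_Nil 0 frame_refl)
  next
    case (Suc m)
    then have D: "[D..<C] = D # [Suc D..<C]"
      by (simp add: upt_conv_Cons)
    let ?R = "R(freg (2 + D) := of_bool (D = 0), vreg (2 + D) := 0)"
    have fr: "frame R ?R" by (auto simp: frame_def)
    show ?case
      unfolding D list.map
    proof (intro wp_seqs_Cons wp_Seq wp_Const w)
      show "is_word w 0" using w[of False] by simp
      show "wp (seqs (map (\<lambda>c. Ins (Const (freg (2 + c)) (of_bool (c = 0))) ;;
          Ins (Const (vreg (2 + c)) 0)) [Suc D..<C])) Q ?R"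
      proof (rule Suc.hyps(1))
        show "holds ?R (2 + e) (if e = 0 then {0} else {})" if "e < Suc D" for e
          using Suc.prems(2)[of e] that by (cases "e = D") (auto simp: holds_def)
        show "m = C - Suc D" "Suc D \<le> C" using Suc.hyps(2) by auto
        show "Q R'" if "frame ?R R'"
          "\<And>e. e < C \<Longrightarrow> holds R' (2 + e) (if e = 0 then {0} else {})" for R'
          using Suc.prems(3)[OF frame_trans[OF fr that(1)] that(2)] .
      qed
    qed
  qed
  from this[of 0] assms show ?thesis
    by (simp add: dp_init_def)
qed

definition results :: "(nat \<Rightarrow> nat) \<Rightarrow> int set" where
  "results \<rho> = extend \<rho> (base_summands k s a) (table \<rho> n {..<s})"

text \<open>The bound makes \<open>A\<close> finite, hence \<open>Min A\<close> meaningful, and lets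
  the final value be moved by an addition.\<close>

definition best :: "int set \<Rightarrow> (nat \<Rightarrow> int) \<Rightarrow> bool" where
  "best A R \<longleftrightarrow> holds R 0 A \<and> (\<forall>x\<in>A. \<bar>x\<bar> \<le> int (K * W))"

lemma base_indices: "t \<in> set (base_summands k s a) \<Longrightarrow> indices t \<subseteq> U"
  by (auto simp: base_summands_def)

lemma results_bound:
  assumes "\<forall>j\<in>U. \<rho> j < n" "x \<in> results \<rho>"
  shows "\<bar>x\<bar> \<le> int (K * W)"
proof -
  from assms(2) obtain y where y: "y \<in> table \<rho> n {..<s}" "x = total \<rho> (base_summands k s a) + y"
    by (auto simp: results_def extend_def)
  have "\<bar>total \<rho> (base_summands k s a)\<bar> \<le> int (length (base_summands k s a) * W)"
    by (rule total_bound) (use base_indices assms(1) in blast)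
  moreover have "\<bar>y\<bar> \<le> int (s * (2 * k + 1) * W)"
    by (rule table_bound[OF assms(1) _ y(1)]) auto
  ultimately show ?thesis
    unfolding y(2) K_W by linarith
qed

lemma wp_search:
  assumes R: "assigned \<rho> U R" "best A R"
  shows "wp (search k s a) (\<lambda>R'. assigned \<rho> U R' \<and> best (A \<union> results \<rho>) R') R"
  unfolding search_def
proof (intro wp_Seq wp_dp_init)
  have \<rho>: "\<forall>j\<in>U. \<rho> j < n"
    using R(1) by (auto simp: assigned_def)
  fix R1
  assume R1: "frame R R1" "\<And>e. e < 2 ^ s \<Longrightarrow> holds R1 (2 + e) (if e = 0 then {0} else {})"
  define Inv where "Inv v R' \<longleftrightarrow> assigned \<rho> U R' \<and> holds R' 0 A \<and> R' (nreg k) = int v \<and>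
    (\<forall>e<2 ^ s. holds R' (2 + e) (table \<rho> v (set_decode e)))" for v R'
  have "wp (For (nreg k) (dp_step k s a))
     (wp (relax 0 (base_summands k s a) (2 + set_encode {..<s}))
     (\<lambda>R'. assigned \<rho> U R' \<and> best (A \<union> results \<rho>) R')) R1"
  proof (rule wp_For[where Inv = Inv])
    show "is_word w (int n)" by (rule word_nat) simp
    have "assigned \<rho> U R1" "holds R1 0 A"
      using R R1(1) by (auto simp: best_def intro: assigned_frame holds_frame)
    \<comment> \<open>Code 0 is the empty set, so the initial table agrees with
      \<open>matchings_0\<close>.\<close>
    moreover have "set_decode e = {} \<longleftrightarrow> e = 0" for e
      by (metis set_decode_inverse set_decode_zero)
    ultimately show "Inv 0 (R1(nreg k := 0))"
      using R1(2) by (auto simp: Inv_def assigned_def holds_def matchings_0)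
  next
    fix v R' assume "Inv v R'" "v \<le> n"
    then show "R' (nreg k) = int v \<and> R' 0 = int n"
      by (auto simp: Inv_def assigned_def)
  next
    fix v R' assume I: "Inv v R'" and v: "v < n"
    show "wp (dp_step k s a) (\<lambda>R''. R'' (nreg k) = int v \<and> R'' 3 = 1 \<and>
      Inv (Suc v) (R''(nreg k := int (Suc v)))) R'"
      unfolding dp_step_def
    proof (rule wp_dp_step_list)
      show "assigned (\<rho>(k := v)) (insert k U) R'"
        using I v by (auto simp: Inv_def assigned_def)
      show "holds R' (2 + e) (table \<rho> (if e < 2 ^ s then v else Suc v) (set_decode e))"
        if "e < 2 ^ s" for e
        using I that by (auto simp: Inv_def)
      fix R'' assume R'': "frame R' R''"
        "\<And>e. e < 2 ^ s \<Longrightarrow> holds R'' (2 + e) (table \<rho> (Suc v) (set_decode e))"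
      then have "assigned \<rho> U R''" "holds R'' 0 A" "R'' (nreg k) = int v"
        using I by (auto simp: Inv_def frame_def intro: assigned_frame holds_frame)
      with R''(2) show "R'' (nreg k) = int v \<and> R'' 3 = 1 \<and>
          Inv (Suc v) (R''(nreg k := int (Suc v)))"
        by (auto simp: Inv_def assigned_def holds_def)
    qed simp
  next
    fix R2 assume I: "Inv n R2"
    show "wp (relax 0 (base_summands k s a) (2 + set_encode {..<s}))
      (\<lambda>R'. assigned \<rho> U R' \<and> best (A \<union> results \<rho>) R') R2"
    proof (rule wp_relax)
      show "assigned \<rho> (\<Union> (indices ` set (base_summands k s a))) R2"
      proof (rule assigned_subset)
      show "assigned \<rho> U R2" using I by (simp add: Inv_def)
    qed (use base_indices in blast)
      show "holds R2 0 A" using I by (simp add: Inv_def)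
      have "holds R2 (2 + e) (table \<rho> n (set_decode e))" if "e < 2 ^ s" for e
        using I that by (simp add: Inv_def)
      from this[OF set_encode_lessThan]
      show "holds R2 (2 + set_encode {..<s}) (table \<rho> n {..<s})" by simp
      show "\<bar>x\<bar> + int (length (base_summands k s a) * W) \<le> int (K * W)"
        if "x \<in> table \<rho> n {..<s}" for x
        using table_bound[OF \<rho> order_refl that order_refl] unfolding K_W by linarith
      show "int (length (base_summands k s a) * W) \<le> int (K * W)"
        unfolding K_W by simp
      show "\<bar>x\<bar> \<le> int (K * W)" if "x \<in> A" for x
        using R(2) that by (simp add: best_def)
      fix R3 assume R3: "\<And>r. r \<notin> temp \<Longrightarrow> r \<noteq> freg 0 \<Longrightarrow> r \<noteq> vreg 0 \<Longrightarrow> R3 r = R2 r"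
        "holds R3 0 (A \<union> extend \<rho> (base_summands k s a) (table \<rho> n {..<s}))"
      have "assigned \<rho> U R2" using I by (simp add: Inv_def)
      then have "assigned \<rho> U R3"
        by (rule assigned_cong) (auto simp: R3)
      with R3(2) R(2) results_bound[OF \<rho>]
      show "assigned \<rho> U R3 \<and> best (A \<union> results \<rho>) R3"
        by (auto simp: best_def results_def)
    qed auto
  qed
  then show "wp (For (nreg k) (dp_step k s a))
     (wp (relax 0 (base_summands k s a) (2 + set_encode {..<s}))
     (\<lambda>R'. assigned \<rho> U R' \<and> best (A \<union> results \<rho>) R')) R1" .
qed

section \<open>Enumeration of the images of \<open>U\<close>\<close>

fun all_results :: "nat list \<Rightarrow> (nat \<Rightarrow> nat) \<Rightarrow> int set" where
  "all_results [] \<rho> = results \<rho>"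
| "all_results (j # js) \<rho> = (\<Union>u<n. all_results js (\<rho>(j := u)))"

text \<open>\<open>J\<close> holds the pattern vertices fixed by the enclosing loops and has grown
  to \<open>U\<close> when the innermost body is reached. Outside the loop over \<open>j\<close>
  nothing is claimed about \<open>nreg j\<close>, which is why \<open>assigned\<close> carries a
  domain.\<close>

lemma wp_nest:
  assumes "assigned \<rho> J R" "best A R" "J \<union> set js = U" "J \<inter> set js = {}" "distinct js"
  shows "wp (nest js (search k s a)) (\<lambda>R'. assigned \<rho> J R' \<and> best (A \<union> all_results js \<rho>) R') R"
  using assms
proof (induction js arbitrary: \<rho> J R A)
  case Nil
  then show ?case using wp_search by (simp add: nest_def)
next
  case (Cons j js)
  define Inv where "Inv v R' \<longleftrightarrow> assigned \<rho> J R' \<and> R' (nreg j) = int v \<and>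
    best (A \<union> (\<Union>u<v. all_results js (\<rho>(j := u)))) R'" for v R'
  have j: "j \<notin> J" using Cons.prems by auto
  have "wp (For (nreg j) (nest js (search k s a)))
    (\<lambda>R'. assigned \<rho> J R' \<and> best (A \<union> all_results (j # js) \<rho>) R') R"
  proof (rule wp_For[where Inv = Inv])
    show "is_word w (int n)" by (rule word_nat) simp
    show "Inv 0 (R(nreg j := 0))"
      using Cons.prems j by (auto simp: Inv_def assigned_def best_def holds_def)
  next
    fix v R' assume I: "Inv v R'" and v: "v < n"
    have "wp (nest js (search k s a)) (\<lambda>R''. assigned (\<rho>(j := v)) (insert j J) R'' \<and>
      best (A \<union> (\<Union>u<v. all_results js (\<rho>(j := u))) \<union> all_results js (\<rho>(j := v))) R'') R'"
    proof (rule Cons.IH)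
      show "assigned (\<rho>(j := v)) (insert j J) R'"
        using I v by (auto simp: Inv_def assigned_def)
    qed (use I Cons.prems in \<open>auto simp: Inv_def\<close>)
    then show "wp (nest js (search k s a)) (\<lambda>R''. R'' (nreg j) = int v \<and> R'' 3 = 1 \<and>
      Inv (Suc v) (R''(nreg j := int (Suc v)))) R'"
    proof (rule wp_mono, elim conjE)
      fix R'' assume R'': "assigned (\<rho>(j := v)) (insert j J) R''"
        "best (A \<union> (\<Union>u<v. all_results js (\<rho>(j := u))) \<union> all_results js (\<rho>(j := v))) R''"
      have "A \<union> (\<Union>u<v. all_results js (\<rho>(j := u))) \<union> all_results js (\<rho>(j := v)) =
         A \<union> (\<Union>u<Suc v. all_results js (\<rho>(j := u)))"
        by (auto simp: lessThan_Suc)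
      with R'' j show "R'' (nreg j) = int v \<and> R'' 3 = 1 \<and>
          Inv (Suc v) (R''(nreg j := int (Suc v)))"
        by (auto simp: Inv_def assigned_def best_def holds_def split: if_splits)
    qed
  qed (auto simp: Inv_def assigned_def)
  then show ?case by (simp add: nest_def)
qed

lemma wp_program:
  defines "A \<equiv> all_results [s..<k] (\<lambda>_. 0)"
  shows "wp (program k s a) (\<lambda>R'. (if R' 0 = 0 then None else Some (R' 1)) =
    (if A = {} then None else Some (Min A))) ((\<lambda>_. 0)(0 := int n))"
proof -
  have w1: "is_word w 1" by (rule word_small) auto
  let ?R = "(\<lambda>_. 0)(0 := int n, 3 := 1)"
  have "wp (nest [s..<k] (search k s a)) (\<lambda>R'. assigned (\<lambda>_. 0) {} R' \<and> best ({} \<union> A) R') ?R"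
    unfolding A_def by (rule wp_nest) (auto simp: assigned_def best_def holds_def)
  then have "wp (nest [s..<k] (search k s a)) (wp (Ins (Add 1 (vreg 0) 2) ;; Ins (Add 0 (freg 0) 2))
      (\<lambda>R'. (if R' 0 = 0 then None else Some (R' 1)) =
        (if A = {} then None else Some (Min A)))) ?R"
  proof (rule wp_mono, elim conjE)
    fix R assume R: "assigned (\<lambda>_. 0) {} R" "best ({} \<union> A) R"
    then have h: "holds R 0 A" and b: "\<And>x. x \<in> A \<Longrightarrow> \<bar>x\<bar> \<le> int (K * W)"
      by (auto simp: best_def)
    have "finite A"
      by (rule finite_subset[of _ "{- int (K * W)..int (K * W)}"]) (use b in fastforce)+
    with h have m: "R (vreg 0) = Min A" if "A \<noteq> {}"
      using that by (auto simp: holds_def intro!: Min_eqI[symmetric])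
    have "is_word w (R (vreg 0))" "is_word w (R (freg 0))"
      using h b w1 by (auto simp: holds_def is_word_def intro: word_weight[unfolded is_word_def] split: if_splits)
    moreover have "R 2 = 0" using R by (auto simp: assigned_def)
    ultimately show "wp (Ins (Add 1 (vreg 0) 2) ;; Ins (Add 0 (freg 0) 2))
      (\<lambda>R'. (if R' 0 = 0 then None else Some (R' 1)) =
        (if A = {} then None else Some (Min A))) R"
      using m h by (intro wp_Seq wp_Add) (auto simp: holds_def split: if_splits)
  qed
  then show ?thesis
    unfolding program_def by (intro wp_Seq[of "Ins (Const _ _)"] wp_Const wp_Seq[of "nest _ _"] w1)
qed

end

section \<open>Correctness with respect to copies of the pattern\<close>

text \<open>Each pattern edge is charged to its smaller endpoint, so the sum over
  \<open>i < k\<close> counts it once. With the independent vertices numbered first, every edge at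
  one of them is charged to that vertex.\<close>

definition pattern_weight :: "('b \<Rightarrow> int) \<Rightarrow> ('b set \<Rightarrow> int) \<Rightarrow> nat \<Rightarrow> (nat \<Rightarrow> nat \<Rightarrow> bool) \<Rightarrow>
    (nat \<Rightarrow> 'b) \<Rightarrow> nat \<Rightarrow> int" where
  "pattern_weight nw ew k a p i = nw (p i) + (\<Sum>j | i < j \<and> j < k \<and> a i j. ew {p i, p j})"

text \<open>Edges are preserved but need not be reflected, because a copy need not be
  induced.\<close>

definition embedding :: "'b graph \<Rightarrow> nat \<Rightarrow> (nat \<Rightarrow> nat \<Rightarrow> bool) \<Rightarrow> (nat \<Rightarrow> 'b) \<Rightarrow> bool" where
  "embedding G k a p \<longleftrightarrow> inj_on p {..<k} \<and> p ` {..<k} \<subseteq> verts G \<and>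
     (\<forall>i j. i < j \<and> j < k \<and> a i j \<longrightarrow> {p i, p j} \<in> edges G)"

context copy_machine
begin

lemma base_valid: "all_valid \<rho> (base_summands k s a) \<longleftrightarrow>
    (\<forall>i j. s \<le> i \<and> i < j \<and> j < k \<longrightarrow> \<rho> i \<noteq> \<rho> j \<and> (a i j \<longrightarrow> {\<rho> i, \<rho> j} \<in> edges G))"
proof -
  have "all_valid \<rho> (base_summands k s a) \<longleftrightarrow> (\<forall>i\<in>U. \<forall>j\<in>{Suc i..<k}.
      \<rho> i \<noteq> \<rho> j \<and> (a i j \<longrightarrow> {\<rho> i, \<rho> j} \<in> edges G))"
    by (auto simp: base_summands_def ball_Un)
  then show ?thesis by auto
qed

lemma edge_cost: "all_valid \<rho> (map (Edge i) js) \<Longrightarrow> distinct js \<Longrightarrow>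
    total \<rho> (map (Edge i) js) = (\<Sum>j\<in>set js. ew {\<rho> i, \<rho> j})"
  by (induction js) auto

lemma total_Neq [simp]: "total \<rho> (map (Neq i) js) = 0" "sum_list (map (cost \<rho> \<circ> Neq i) js) = 0"
  by (induction js) auto

lemma base_total:
  assumes "all_valid \<rho> (base_summands k s a)"
  shows "total \<rho> (base_summands k s a) = (\<Sum>i\<in>U. pattern_weight nw ew k a \<rho> i)"
proof -
  let ?row = "\<lambda>i. map (Neq i) [Suc i..<k] @ map (Edge i) (filter (a i) [Suc i..<k])"
  have row: "total \<rho> (?row i) = (\<Sum>j | i < j \<and> j < k \<and> a i j. ew {\<rho> i, \<rho> j})" if "i \<in> U" for i
  proof -
    have "{j. i < j \<and> j < k \<and> a i j} = set (filter (a i) [Suc i..<k])" by auto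
    moreover have "all_valid \<rho> (map (Edge i) (filter (a i) [Suc i..<k]))"
      using assms that by (auto simp: base_valid)
    ultimately show ?thesis
      by (simp only: edge_cost distinct_filter distinct_upt map_append sum_list_append total_Neq add_0)
  qed
  have "total \<rho> (concat (map ?row xs)) = (\<Sum>i\<leftarrow>xs. total \<rho> (?row i))" for xs
    by (induction xs) auto
  then have "total \<rho> (concat (map ?row [s..<k])) = (\<Sum>i\<in>U. total \<rho> (?row i))"
    by (simp only: interv_sum_list_conv_sum_set_nat set_upt)
  also have "\<dots> = (\<Sum>i\<in>U. \<Sum>j | i < j \<and> j < k \<and> a i j. ew {\<rho> i, \<rho> j})"
    using row by (rule sum.cong[OF refl])
  finally show ?thesis
    by (simp add: base_summands_def pattern_weight_def sum.distrib comp_def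
        interv_sum_list_conv_sum_set_nat)
qed

lemma match_ok_iff:
  "match_ok \<rho> i v \<longleftrightarrow> (\<forall>j\<in>U. v \<noteq> \<rho> j \<and> (a i j \<longrightarrow> {v, \<rho> j} \<in> edges G))"
  by (auto simp: match_ok_def match_summands_def ball_Un)

lemma match_cost_eq:
  assumes "match_ok \<rho> i v"
  shows "match_cost \<rho> i v = nw v + (\<Sum>j | j \<in> U \<and> a i j. ew {v, \<rho> j})"
proof -
  let ?js = "filter (a i) [s..<k]"
  have "total (\<rho>(k := v)) (map (Edge k) ?js) = (\<Sum>j\<in>set ?js. ew {(\<rho>(k := v)) k, (\<rho>(k := v)) j})"
    using assms by (intro edge_cost) (auto simp: match_ok_iff)
  also have "\<dots> = (\<Sum>j | j \<in> U \<and> a i j. ew {v, \<rho> j})"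
    by (rule sum.cong) auto
  finally show ?thesis
    by (simp add: match_cost_def match_summands_def)
qed

lemma all_results_iff:
  "distinct js \<Longrightarrow> x \<in> all_results js \<rho> \<longleftrightarrow>
    (\<exists>\<sigma>. (\<forall>i. i \<notin> set js \<longrightarrow> \<sigma> i = \<rho> i) \<and> (\<forall>j\<in>set js. \<sigma> j < n) \<and> x \<in> results \<sigma>)"
proof (induction js arbitrary: \<rho>)
  case Nil
  have "\<sigma> = \<rho>" if "\<forall>i. \<sigma> i = \<rho> i" for \<sigma> using that by auto
  then show ?case by auto
next
  case (Cons j js)
  show ?case (is "_ \<longleftrightarrow> ?R")
  proof
    assume "x \<in> all_results (j # js) \<rho>"
    then obtain u where "u < n" "x \<in> all_results js (\<rho>(j := u))" by auto
    with Cons obtain \<sigma> where "\<forall>i. i \<notin> set js \<longrightarrow> \<sigma> i = (\<rho>(j := u)) i" "\<forall>j\<in>set js. \<sigma> j < n"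
      "x \<in> results \<sigma>" by auto
    with \<open>u < n\<close> Cons.prems show ?R by (intro exI[of _ \<sigma>]) auto
  next
    assume ?R
    then obtain \<sigma> where \<sigma>: "\<forall>i. i \<notin> set (j # js) \<longrightarrow> \<sigma> i = \<rho> i" "\<forall>j\<in>set (j # js). \<sigma> j < n"
      "x \<in> results \<sigma>" by blast
    then have "\<forall>i. i \<notin> set js \<longrightarrow> \<sigma> i = (\<rho>(j := \<sigma> j)) i" by auto
    moreover have "distinct js" using Cons.prems by simp
    ultimately have "x \<in> all_results js (\<rho>(j := \<sigma> j))"
      unfolding Cons.IH[OF \<open>distinct js\<close>] using \<sigma>(2,3) by (intro exI[of _ \<sigma>]) simp
    with \<sigma>(2) show "x \<in> all_results (j # js) \<rho>" by auto
  qed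
qed

text \<open>An embedding splits into its restriction to \<open>U\<close> and an injective choice on
  \<open>{..<s}\<close>. By independence, the conditions and charges of \<open>i < s\<close> involve
  only its own image and the images of \<open>U\<close>; the choices interact through injectivity
  alone.\<close>

lemma all_results_eq:
  assumes indep: "\<And>i j. i < s \<Longrightarrow> j < s \<Longrightarrow> \<not> a i j"
  shows "all_results [s..<k] (\<lambda>_. 0) =
    {\<Sum>i<k. pattern_weight nw ew k a p i |p. embedding G k a p}"
proof -
  have split: "{..<k} = {..<s} \<union> U" "{..<s} \<inter> U = {}"
    using s_le by auto
  have late: "{j. i < j \<and> j < k \<and> a i j} = {j. j \<in> U \<and> a i j}" if "i < s" for i
    using indep that by auto (meson not_le)
  have sum_split: "(\<Sum>i<k. pattern_weight nw ew k a p i) =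
      (\<Sum>i\<in>U. pattern_weight nw ew k a p i) + (\<Sum>i<s. pattern_weight nw ew k a p i)" for p
    unfolding split(1) using split(2) by (subst sum.union_disjoint) auto
  have key: "embedding G k a p \<longleftrightarrow> (\<forall>j\<in>U. p j < n) \<and> all_valid p (base_summands k s a) \<and>
      inj_on p {..<s} \<and> (\<forall>i\<in>{..<s}. p i < n \<and> match_ok p i (p i))"
    (is "?L \<longleftrightarrow> ?R") for p
  proof
    assume L: ?L
    then have inj: "inj_on p {..<k}"
      by (simp add: embedding_def)
    have lt: "p i < n" if "i < k" for i
      using L that by (auto simp: embedding_def graph(2))
    have ne: "p i \<noteq> p j" if "i < j" "j < k" for i j
      using inj_onD[OF inj, of i j] that by auto
    have adj: "{p i, p j} \<in> edges G" if "i < j" "j < k" "a i j" for i j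
      using L that by (simp add: embedding_def)
    have "inj_on p {..<s}"
      using inj s_le by (auto intro: inj_on_subset)
    moreover have "p i \<noteq> p j" if "i < s" "j \<in> U" for i j
      using ne[of i j] that by simp
    moreover have "{p i, p j} \<in> edges G" if "i < s" "j \<in> U" "a i j" for i j
      using adj[of i j] that by simp
    ultimately show ?R
      unfolding base_valid match_ok_iff using ne adj lt s_le by simp
  next
    assume R: ?R
    have ne: "p i \<noteq> p j" if "i < j" "j < k" for i j
      using R that by (cases "i < s"; cases "j < s") (auto simp: inj_on_def base_valid match_ok_iff)
    have "inj_on p {..<k}"
      by (rule linorder_inj_onI) (use ne in auto)
    moreover have "p i < n" if "i < k" for i
      using R that by (cases "i < s") auto
    moreover have "{p i, p j} \<in> edges G" if "i < j" "j < k" "a i j" for i j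
      using R that indep[of i j] by (cases "i < s"; cases "j < s") (auto simp: base_valid match_ok_iff)
    ultimately show ?L
      by (auto simp: embedding_def graph(2))
  qed
  have weight: "(\<Sum>i<k. pattern_weight nw ew k a p i) =
      total p (base_summands k s a) + (\<Sum>i<s. match_cost p i (p i))" if "embedding G k a p" for p
    unfolding sum_split using that unfolding key
    by (auto simp: base_total match_cost_eq pattern_weight_def late intro!: sum.cong)
  have "x \<in> all_results [s..<k] (\<lambda>_. 0) \<longleftrightarrow>
      (\<exists>p. embedding G k a p \<and> x = (\<Sum>i<k. pattern_weight nw ew k a p i))" for x
  proof
    assume "x \<in> all_results [s..<k] (\<lambda>_. 0)"
    then obtain \<sigma> where \<sigma>: "\<forall>j\<in>U. \<sigma> j < n" "x \<in> results \<sigma>"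
      by (subst (asm) all_results_iff) auto
    then obtain q where q: "x = total \<sigma> (base_summands k s a) + (\<Sum>i<s. match_cost \<sigma> i (q i))"
      "all_valid \<sigma> (base_summands k s a)" "inj_on q {..<s}"
      "\<forall>i\<in>{..<s}. q i < n \<and> match_ok \<sigma> i (q i)"
      by (auto simp: results_def extend_def matchings_def)
    \<comment> \<open>\<open>results \<sigma>\<close> looks at \<open>\<sigma>\<close> on
      \<open>U\<close> only, so the values below \<open>s\<close> may be replaced by
      \<open>q\<close>.\<close>
    define p where "p i = (if i < s then q i else \<sigma> i)" for i
    have 1: "match_ok p = match_ok \<sigma>"
      by (intro ext) (auto simp: match_ok_iff p_def)
    have 2: "all_valid p (base_summands k s a)"
      using q(2) unfolding base_valid p_def by auto
    have p: "embedding G k a p"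
      unfolding key 1 using q \<sigma> 2 by (auto simp: p_def inj_on_def)
    have 3: "total p (base_summands k s a) = total \<sigma> (base_summands k s a)"
      unfolding base_total[OF 2] base_total[OF q(2)]
      by (intro sum.cong refl) (auto simp: p_def pattern_weight_def)
    have 4: "match_cost p i (q i) = match_cost \<sigma> i (q i)" if "i < s" for i
      using q(4) that by (subst (1 2) match_cost_eq) (auto simp: 1 p_def intro!: sum.cong)
    have "x = (\<Sum>i<k. pattern_weight nw ew k a p i)"
      unfolding weight[OF p] q(1) 3 using 4 by (auto simp: p_def intro!: sum.cong)
    with p show "\<exists>p. embedding G k a p \<and> x = (\<Sum>i<k. pattern_weight nw ew k a p i)" by blast
  next
    assume "\<exists>p. embedding G k a p \<and> x = (\<Sum>i<k. pattern_weight nw ew k a p i)"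
    then obtain p where p: "embedding G k a p" and x: "x = (\<Sum>i<k. pattern_weight nw ew k a p i)"
      by blast
    \<comment> \<open>The default 0 off \<open>U\<close> is the value of the function from which the
      enumeration starts.\<close>
    define \<sigma> where "\<sigma> i = (if i \<in> U then p i else 0)" for i
    note p' = p[unfolded key]
    have 1: "match_ok \<sigma> = match_ok p"
      by (intro ext) (auto simp: match_ok_iff \<sigma>_def)
    have 2: "all_valid \<sigma> (base_summands k s a)"
      using p' unfolding base_valid \<sigma>_def by auto
    have 3: "total \<sigma> (base_summands k s a) = total p (base_summands k s a)"
      using p' unfolding base_total[OF 2]
      by (subst base_total) (auto simp: \<sigma>_def pattern_weight_def intro!: sum.cong)
    have 4: "match_cost \<sigma> i (p i) = match_cost p i (p i)" if "i < s" for i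
      using p' that by (subst (1 2) match_cost_eq) (auto simp: 1 \<sigma>_def intro!: sum.cong)
    have "x = total \<sigma> (base_summands k s a) + (\<Sum>i<s. match_cost \<sigma> i (p i))"
      unfolding x weight[OF p] 3 using 4 by simp
    then have "x \<in> results \<sigma>"
      using p' 1 2 unfolding results_def extend_def matchings_def by auto
    then show "x \<in> all_results [s..<k] (\<lambda>_. 0)"
      using p' by (subst all_results_iff) (auto simp: \<sigma>_def intro!: exI[of _ \<sigma>])
  qed
  then show ?thesis by auto
qed

end

section \<open>Copies of the pattern as injective numberings\<close>

lemma isomorphic_iff_numbering:
  assumes e: "bij_betw e {..<k} (verts H)"
  shows "isomorphic H K \<longleftrightarrow> (\<exists>p. bij_betw p {..<k} (verts K) \<and>
    (\<forall>i<k. \<forall>j<k. {e i, e j} \<in> edges H \<longleftrightarrow> {p i, p j} \<in> edges K))"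
proof
  assume "isomorphic H K"
  then obtain f where f: "bij_betw f (verts H) (verts K)"
    "\<forall>u\<in>verts H. \<forall>v\<in>verts H. {u, v} \<in> edges H \<longleftrightarrow> {f u, f v} \<in> edges K"
    by (auto simp: isomorphic_def)
  have "e i \<in> verts H" if "i < k" for i
    using e that by (auto simp: bij_betw_def)
  with f bij_betw_trans[OF e f(1)]
  show "\<exists>p. bij_betw p {..<k} (verts K) \<and>
    (\<forall>i<k. \<forall>j<k. {e i, e j} \<in> edges H \<longleftrightarrow> {p i, p j} \<in> edges K)"
    by (intro exI[of _ "f \<circ> e"]) auto
next
  assume "\<exists>p. bij_betw p {..<k} (verts K) \<and>
    (\<forall>i<k. \<forall>j<k. {e i, e j} \<in> edges H \<longleftrightarrow> {p i, p j} \<in> edges K)"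
  then obtain p where p: "bij_betw p {..<k} (verts K)"
    "\<forall>i<k. \<forall>j<k. {e i, e j} \<in> edges H \<longleftrightarrow> {p i, p j} \<in> edges K" by blast
  define g where "g = the_inv_into {..<k} e"
  have g: "bij_betw g (verts H) {..<k}"
    unfolding g_def using e by (rule bij_betw_the_inv_into)
  have "e (g u) = u" "g u < k" if "u \<in> verts H" for u
  proof -
    show "e (g u) = u"
      unfolding g_def using e that by (simp add: bij_betw_def f_the_inv_into_f)
    show "g u < k" using g that by (auto simp: bij_betw_def)
  qed
  with p bij_betw_trans[OF g p(1)] show "isomorphic H K"
    unfolding isomorphic_def by (intro exI[of _ "p \<circ> g"]) (metis comp_apply)
qed

text \<open>A numbering of a copy determines its edges as the images of the pattern edges;
  conversely, an embedding yields the copy with just these edges. Only sets of weights are compared,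
  so different embeddings may share a copy.\<close>

lemma total_weight_copies:
  assumes H: "simple_graph H" and G: "simple_graph G" and e: "bij_betw e {..<k} (verts H)"
  defines "a \<equiv> \<lambda>i j. {e i, e j} \<in> edges H"
  shows "total_weight nw ew ` copies H G =
    {\<Sum>i<k. pattern_weight nw ew k a p i |p. embedding G k a p}"
proof -
  have a: "\<not> a i i" "a i j \<longleftrightarrow> a j i" for i j
    using H by (auto simp: a_def simple_graph_def insert_commute)
  define pairs where "pairs = (SIGMA i:{..<k}. {j. i < j \<and> j < k \<and> a i j})"
  have tw: "total_weight nw ew K = (\<Sum>i<k. pattern_weight nw ew k a p i)"
    if p: "inj_on p {..<k}" and V: "verts K = p ` {..<k}"
      and E: "edges K = (\<lambda>(i, j). {p i, p j}) ` pairs" for K p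
  proof -
    \<comment> \<open>Each edge of the copy comes from a single pair, since \<open>i < j\<close>
      excludes the swapped one; the edge sum can thus be reindexed.\<close>
    have "inj_on (\<lambda>(i, j). {p i, p j}) pairs"
    proof (rule inj_onI, clarify)
      fix i j i' j' assume *: "(i, j) \<in> pairs" "(i', j') \<in> pairs" "{p i, p j} = {p i', p j'}"
      then have sub: "{i, j} \<subseteq> {..<k}" "{i', j'} \<subseteq> {..<k}" "p ` {i, j} = p ` {i', j'}"
        by (auto simp: pairs_def)
      then have "{i, j} = {i', j'}"
        using inj_on_image_eq_iff[OF p sub(1,2)] sub(3) by blast
      with * show "i = i' \<and> j = j'"
        by (auto simp: pairs_def doubleton_eq_iff)
    qed
    then have "(\<Sum>e\<in>edges K. ew e) = (\<Sum>(i, j)\<in>pairs. ew {p i, p j})"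
      unfolding E by (subst sum.reindex) (auto simp: case_prod_unfold)
    also have "\<dots> = (\<Sum>i<k. \<Sum>j | i < j \<and> j < k \<and> a i j. ew {p i, p j})"
      unfolding pairs_def by (subst sum.Sigma) auto
    finally show ?thesis
      using p unfolding total_weight_def pattern_weight_def V
      by (simp add: sum.reindex sum.distrib)
  qed
  have edges_eq: "edges K = (\<lambda>(i, j). {p i, p j}) ` pairs"
    if K: "simple_graph K" and p: "bij_betw p {..<k} (verts K)"
      and iff: "\<forall>i<k. \<forall>j<k. a i j \<longleftrightarrow> {p i, p j} \<in> edges K" for K p
  proof (intro equalityI subsetI)
    fix x assume x: "x \<in> edges K"
    then obtain u v where uv: "x = {u, v}" "u \<noteq> v" "u \<in> verts K" "v \<in> verts K"
      using K by (auto simp: simple_graph_def card_2_iff)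
    from uv(3,4) have "u \<in> p ` {..<k}" "v \<in> p ` {..<k}"
      using p by (simp_all add: bij_betw_def)
    then obtain i j where ij: "u = p i" "v = p j" "i < k" "j < k"
      by blast
    then have "i \<noteq> j" using uv(2) by auto
    then have "i < j \<or> j < i" by linarith
    then show "x \<in> (\<lambda>(i, j). {p i, p j}) ` pairs"
    proof
      assume "i < j"
      then have "(i, j) \<in> pairs" using ij iff x uv by (auto simp: pairs_def)
      then show ?thesis using uv ij by force
    next
      assume "j < i"
      then have "(j, i) \<in> pairs" using ij iff x uv by (auto simp: pairs_def insert_commute)
      then show ?thesis using uv ij by (force simp: insert_commute)
    qed
  qed (use iff in \<open>auto simp: pairs_def\<close>)
  show ?thesis
  proof (intro equalityI subsetI)
    fix x assume "x \<in> total_weight nw ew ` copies H G"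
    then obtain K where K: "subgraph K G" "isomorphic H K" "x = total_weight nw ew K"
      by (auto simp: copies_def)
    then obtain p where p: "bij_betw p {..<k} (verts K)"
      "\<forall>i<k. \<forall>j<k. a i j \<longleftrightarrow> {p i, p j} \<in> edges K"
      unfolding isomorphic_iff_numbering[OF e] a_def by blast
    have "x = (\<Sum>i<k. pattern_weight nw ew k a p i)"
      unfolding K(3) using p K(1)
      by (intro tw edges_eq) (auto simp: bij_betw_def subgraph_def)
    moreover have "embedding G k a p"
      unfolding embedding_def
    proof (intro conjI allI impI)
      show "inj_on p {..<k}" "p ` {..<k} \<subseteq> verts G"
        using p K(1) by (auto simp: bij_betw_def subgraph_def)
      show "{p i, p j} \<in> edges G" if "i < j \<and> j < k \<and> a i j" for i j
        using p(2) that K(1) by (auto simp: subgraph_def)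
    qed
    ultimately show "x \<in> {\<Sum>i<k. pattern_weight nw ew k a p i |p. embedding G k a p}" by blast
  next
    fix x assume "x \<in> {\<Sum>i<k. pattern_weight nw ew k a p i |p. embedding G k a p}"
    then obtain p where x: "x = (\<Sum>i<k. pattern_weight nw ew k a p i)" and p: "embedding G k a p"
      by blast
    \<comment> \<open>Taking the images of pattern edges, and not all edges of \<open>G\<close>
      between the chosen vertices, makes adjacency agree in both directions.\<close>
    define K where "K = Graph (p ` {..<k}) ((\<lambda>(i, j). {p i, p j}) ` pairs)"
    have inj: "inj_on p {..<k}" using p by (simp add: embedding_def)
    have "simple_graph K"
      using inj by (auto simp: simple_graph_def K_def pairs_def card_2_iff inj_on_def)
    then have "subgraph K G"
      using p by (auto simp: subgraph_def K_def pairs_def embedding_def)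
    moreover have "a i j \<longleftrightarrow> {p i, p j} \<in> edges K" if ij: "i < k" "j < k" for i j
    proof
      assume "a i j"
      with ij a consider "(i, j) \<in> pairs" | "(j, i) \<in> pairs"
        by (metis (mono_tags, lifting) SigmaI lessThan_iff linorder_neqE_nat mem_Collect_eq pairs_def)
      then show "{p i, p j} \<in> edges K"
        by cases (force simp: K_def insert_commute)+
    next
      assume "{p i, p j} \<in> edges K"
      then obtain i' j' where *: "(i', j') \<in> pairs" "{p i, p j} = {p i', p j'}"
        by (auto simp: K_def)
      then have sub: "{i, j} \<subseteq> {..<k}" "{i', j'} \<subseteq> {..<k}" "p ` {i, j} = p ` {i', j'}"
        using ij by (auto simp: pairs_def)
      then have "{i, j} = {i', j'}"
        using inj_on_image_eq_iff[OF inj sub(1,2)] sub(3) by blast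
      with * a show "a i j"
        by (auto simp: pairs_def doubleton_eq_iff)
    qed
    then have "isomorphic H K"
      unfolding isomorphic_iff_numbering[OF e] using inj
      by (intro exI[of _ p]) (auto simp: a_def bij_betw_def K_def)
    ultimately have "K \<in> copies H G" by (simp add: copies_def)
    moreover have "x = total_weight nw ew K"
      unfolding x by (rule tw[symmetric, OF inj]) (simp_all add: K_def)
    ultimately show "x \<in> total_weight nw ew ` copies H G" by blast
  qed
qed

section \<open>Running time and word length\<close>

fun depth :: "com \<Rightarrow> nat" where
  "depth Skip = 0"
| "depth (Ins a) = 0"
| "depth (c ;; d) = max (depth c) (depth d)"
| "depth (When a b c) = depth c"
| "depth (For x c) = Suc (depth c)"

text \<open>With base \<open>n + 1\<close> the powers are at least 1 even for \<open>n = 0\<close>,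
  so they absorb the constant overheads.\<close>

lemma time_bound: "\<exists>C. \<forall>n. time n c \<le> C * (n + 1) ^ depth c"
proof (induction c)
  case (Seq c d)
  then obtain C D where C: "\<And>n. time n c \<le> C * (n + 1) ^ depth c"
    and D: "\<And>n. time n d \<le> D * (n + 1) ^ depth d" by blast
  have "time n (c ;; d) \<le> (C + D) * (n + 1) ^ depth (c ;; d)" for n
  proof -
    have "C * (n + 1) ^ depth c \<le> C * (n + 1) ^ depth (c ;; d)"
      "D * (n + 1) ^ depth d \<le> D * (n + 1) ^ depth (c ;; d)"
      by (auto intro!: mult_le_mono2 power_increasing simp del: One_nat_def Suc_eq_plus1 add_Suc_right)
    with C[of n] D[of n] show ?thesis
      unfolding time.simps distrib_right by linarith
  qed
  then show ?case by blast
next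
  case (When a b c)
  then obtain C where C: "\<And>n. time n c \<le> C * (n + 1) ^ depth c" by blast
  have "time n (When a b c) \<le> (C + 2) * (n + 1) ^ depth (When a b c)" for n
    using C[of n] one_le_power[of "n + 1" "depth c"]
    unfolding time.simps depth.simps distrib_right by linarith
  then show ?case by blast
next
  case (For x c)
  then obtain C where C: "\<And>n. time n c \<le> C * (n + 1) ^ depth c" by blast
  \<comment> \<open>Of the 5, 3 pay for the overhead of each round and 2 for entering and leaving
    the loop.\<close>
  have "time n (For x c) \<le> (C + 5) * (n + 1) ^ depth (For x c)" for n
  proof -
    let ?p = "(n + 1) ^ depth c"
    have "1 \<le> ?p" by simp
    then have "time n c + 3 \<le> (C + 3) * ?p"
      using C[of n] unfolding distrib_right by linarith
    then have "n * (time n c + 3) \<le> (n + 1) * ((C + 3) * ?p)"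
      by (intro mult_le_mono) auto
    moreover have "1 * 1 \<le> (n + 1) * ?p"
      using \<open>1 \<le> ?p\<close> by (intro mult_le_mono) simp_all
    moreover have "(n + 1) * ((C + 3) * ?p) + 2 * ((n + 1) * ?p) = (C + 5) * (n + 1) ^ depth (For x c)"
      by (simp add: algebra_simps)
    ultimately show ?thesis unfolding time.simps by linarith
  qed
  then show ?case by blast
qed (auto intro: exI[of _ 1])

lemma depth_seqs: "(\<And>c. c \<in> set cs \<Longrightarrow> depth c = 0) \<Longrightarrow> depth (seqs cs) = 0"
  by (induction cs) (auto simp: seqs_def)

lemma depth_summand_code: "depth (summand_code t) = 0"
  by (cases t) auto

lemma depth_relax: "depth (relax p ts q) = 0"
  by (auto simp: relax_def copy_def depth_summand_code intro!: depth_seqs)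

lemma depth_nest: "depth (nest js c) = length js + depth c"
  by (induction js) (auto simp: nest_def)

text \<open>One loop for each of the \<open>k - s\<close> vertices of \<open>U\<close> and one for
  the scan. The sweep over the \<open>2 ^ s\<close> subsets is unrolled, since its length depends on
  the pattern alone.\<close>

lemma depth_program: "depth (program k s a) = k - s + 1"
proof -
  have "depth (dp_step k s a) = 0" "depth (dp_init (2 ^ s)) = 0"
    by (auto simp: dp_step_def dp_row_def dp_init_def depth_relax intro!: depth_seqs)
  then show ?thesis
    by (simp add: program_def search_def depth_nest depth_relax)
qed

text \<open>The origin of the exponent: for \<open>y = n + W + 2\<close>, which is at least 2,
  \<open>y ^ K\<close> absorbs the factor \<open>K + 1\<close>, while \<open>y ^ 3\<close> exceeds
  \<open>W\<close> and is at least \<open>2 * (n + 2) ^ 2\<close>, which covers the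
  addresses.\<close>

lemma word_capacity:
  fixes n W K w :: nat
  assumes "real (K + 3) * log 2 (real (n + W + 2)) \<le> real w"
  defines "B \<equiv> (n + W + 2) ^ (K + 3)"
  shows "B \<le> 2 ^ w" and "2 * n * n + 2 * n + 2 < B" and "K * W < B"
proof -
  let ?y = "n + W + 2"
  have "real B = 2 powr (real (K + 3) * log 2 (real ?y))"
    by (simp add: B_def powr_powr[symmetric] mult.commute[of "real (K + 3)"] powr_realpow[symmetric]
        del: of_nat_add)
  also have "\<dots> \<le> 2 powr real w" using assms(1) by simp
  also have "\<dots> = real (2 ^ w)" by (simp add: powr_realpow)
  finally show "B \<le> 2 ^ w" by (simp only: of_nat_le_iff)
  have K: "K + 1 \<le> ?y ^ K"
  proof -
    have "K + 1 \<le> 2 ^ K" using less_exp[of K] by linarith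
    also have "\<dots> \<le> ?y ^ K" by (rule power_mono) auto
    finally show ?thesis .
  qed
  have B: "(K + 1) * ?y ^ 3 \<le> B"
    unfolding B_def power_add using K by (rule mult_le_mono1)
  have y3: "2 * (?y * ?y) \<le> ?y ^ 3"
    by (simp add: power3_eq_cube)
  have "(n + 2) * (n + 2) \<le> ?y * ?y" by (intro mult_le_mono) auto
  moreover have "1 * ?y ^ 3 \<le> (K + 1) * ?y ^ 3" by (rule mult_le_mono1) simp
  ultimately have "2 * ((n + 2) * (n + 2)) \<le> B" using y3 B by linarith
  then show "2 * n * n + 2 * n + 2 < B" by (simp add: algebra_simps)
  have "W < ?y" by simp
  also have "\<dots> \<le> ?y ^ 3" by (rule self_le_power) simp_all
  finally have "W < ?y ^ 3" .
  then have "K * W \<le> K * ?y ^ 3" "0 < ?y ^ 3" by (auto intro: mult_le_mono2)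
  then have "K * W < (K + 1) * ?y ^ 3" unfolding distrib_right by linarith
  with B show "K * W < B" by linarith
qed

lemma program_solves:
  assumes H: "simple_graph H" and e: "bij_betw e {..<k} (verts H)" and "s \<le> k"
    and indep: "\<And>i j. i < s \<Longrightarrow> j < s \<Longrightarrow> {e i, e j} \<notin> edges H"
  defines "c \<equiv> program k s (\<lambda>i j. {e i, e j} \<in> edges H)"
  shows "solves_min_copy H (code c 0) (\<lambda>n. time n c)"
proof -
  define a where "a = (\<lambda>i j. {e i, e j} \<in> edges H)"
  define K where "K = (s + 1) * (2 * k + 1) + length (base_summands k s a)"
  show ?thesis
    unfolding solves_min_copy_def
  proof (rule exI[of _ "K + 3"], intro allI impI)
    fix n W w :: nat and G :: "nat graph" and nw ew
    assume G: "simple_graph G" "verts G = {..<n}" and nw: "\<forall>v\<in>verts G. \<bar>nw v\<bar> \<le> int W"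
      and ew: "\<forall>e\<in>edges G. \<bar>ew e\<bar> \<le> int W"
      and w: "real (K + 3) * log 2 (real (n + W + 2)) \<le> real w"
    let ?B = "(n + W + 2) ^ (K + 3)"
    note cap = word_capacity[OF w]
    \<comment> \<open>Words are strictly below \<open>2 ^ w\<close> in magnitude and
      \<open>?B \<le> 2 ^ w\<close>, so magnitudes up to \<open>?B - 1\<close> fit.\<close>
    interpret copy_machine w n "input_mem n G nw ew" G nw ew W K "int ?B - 1" k s a
    proof
      show "is_word w x" if "\<bar>x\<bar> \<le> int ?B - 1" for x
      proof -
        have "int ?B \<le> 2 ^ w" using cap(1) by (metis of_nat_le_iff of_nat_numeral of_nat_power)
        with that show ?thesis unfolding is_word_def by linarith
      qed
      show "int (2 * n * n + 2 * n + 2) \<le> int ?B - 1"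
        using cap(2) by linarith
      show "int (K * W) \<le> int ?B - 1"
        using cap(3) by linarith
    qed (use G nw ew assms(3) in \<open>auto simp: K_def\<close>)
    let ?R = "(\<lambda>_. 0)(0 := int n) :: nat \<Rightarrow> int"
    let ?A = "all_results [s..<k] (\<lambda>_. 0)"
    from wp_program obtain R' where R': "(if R' 0 = 0 then None else Some (R' 1)) =
        (if ?A = {} then None else Some (Min ?A))"
      and run: "\<And>P i. code_at P i c \<Longrightarrow> reach w P (time n c) (Config i ?R (input_mem n G nw ew))
        (Config (i + length (code c i)) R' (input_mem n G nw ew))"
      unfolding wp_def c_def a_def by blast
    have "?A = total_weight nw ew ` copies H G"
      using all_results_eq indep total_weight_copies[OF H G(1) e] by (simp add: a_def)
    then have val: "result (Config i R' M) = min_copy_weight H G nw ew" for i M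
      using R' by (simp only: result_def min_copy_weight_def image_is_empty config.sel)
    have "code_at (code c 0) 0 c"
      by (simp add: code_at_def)
    from run[OF this] obtain t where "t \<le> time n c"
      "(step w (code c 0) ^^ t) (initial n G nw ew)
        (Config (length (code c 0)) R' (input_mem n G nw ew))"
      by (auto simp: reach_def initial_def)
    with val show "\<exists>t ca. t \<le> time n c \<and> halts_in w (code c 0) (initial n G nw ew) t ca \<and>
        result ca = min_copy_weight H G nw ew"
      by (auto simp: halts_in_def intro!: exI[of _ t])
  qed
qed

text \<open>Places the independent set first in the numbering, as \<open>program\<close>
  expects.\<close>

lemma numbering_exists:
  assumes "finite V" "card V = k" "I \<subseteq> V" "card I = s"
  shows "\<exists>e. bij_betw e {..<k} V \<and> e ` {..<s} = I"
proof -
  have "finite I" using assms by (auto intro: finite_subset)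
  have "s \<le> k" using assms card_mono by blast
  obtain f where f: "bij_betw f {..<s} I"
    using finite_same_card_bij[of "{..<s}" I] \<open>finite I\<close> assms by auto
  obtain g where g: "bij_betw g {s..<k} (V - I)"
    using finite_same_card_bij[of "{s..<k}" "V - I"] \<open>finite I\<close> assms by (auto simp: card_Diff_subset)
  define e where "e i = (if i < s then f i else g i)" for i
  have "bij_betw e {..<s} I" "bij_betw e {s..<k} (V - I)"
    using f g by (simp_all add: e_def bij_betw_def inj_on_def)
  moreover from this have "bij_betw e ({..<s} \<union> {s..<k}) (I \<union> (V - I))"
    by (intro bij_betw_combine) auto
  moreover have "{..<s} \<union> {s..<k} = {..<k}" "I \<union> (V - I) = V"
    using \<open>s \<le> k\<close> assms(3) by auto
  ultimately show ?thesis by (metis bij_betw_imp_surj_on)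
qed

lemma polynomial_in_soft_O:
  assumes "\<And>n. T n \<le> C * (n + 1) ^ d"
  shows "(\<lambda>n. real (T n)) \<in> soft_O (\<lambda>n. real n ^ d)"
proof -
  \<comment> \<open>The bound is a plain power, so the logarithm gets exponent 0. The constant comes
    from \<open>n + 1 \<le> 2 * n\<close> for \<open>n \<ge> 1\<close>.\<close>
  have "(\<lambda>n. real (T n)) \<in> O(\<lambda>n. real n ^ d * ln (real n) ^ 0)"
  proof (rule bigoI[of _ "real C * 2 ^ d"], rule eventually_sequentiallyI[of 1])
    fix n :: nat assume "1 \<le> n"
    have "real (T n) \<le> real (C * (n + 1) ^ d)"
      using assms by (rule of_nat_mono)
    also have "\<dots> = real C * (real n + 1) ^ d" by (simp add: add.commute)
    also have "\<dots> \<le> real C * (2 * real n) ^ d"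
      using \<open>1 \<le> n\<close> by (intro mult_left_mono power_mono) auto
    finally show "norm (real (T n)) \<le> real C * 2 ^ d * norm (real n ^ d * ln (real n) ^ 0)"
      by (simp add: power_mult_distrib)
  qed
  then show ?thesis unfolding soft_O_def by blast
qed

theorem theorem4:
  fixes H :: "'a graph" and k s :: nat
  assumes "simple_graph H" and "card (verts H) = k"
    and "\<exists>I. independent_set H I \<and> card I = s"
  shows "\<exists>P T. (\<lambda>n. real (T n)) \<in> soft_O (\<lambda>n. real n ^ (k - s + 1)) \<and> solves_min_copy H P T"
proof -
  from assms(3) obtain I where I: "independent_set H I" "card I = s" by blast
  have fin: "finite (verts H)" using assms(1) by (simp add: simple_graph_def)
  have sub: "I \<subseteq> verts H" using I by (simp add: independent_set_def)
  then have "s \<le> k" using card_mono[OF fin] assms(2) I(2) by blast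
  obtain e where e: "bij_betw e {..<k} (verts H)" "e ` {..<s} = I"
    using numbering_exists[OF fin assms(2) sub I(2)] by blast
  \<comment> \<open>The pattern is fixed, so its adjacency is compiled into the program.\<close>
  let ?c = "program k s (\<lambda>i j. {e i, e j} \<in> edges H)"
  have "solves_min_copy H (code ?c 0) (\<lambda>n. time n ?c)"
    using I(1) e \<open>s \<le> k\<close> assms(1) by (intro program_solves) (auto simp: independent_set_def)
  moreover obtain C where "\<And>n. time n ?c \<le> C * (n + 1) ^ (k - s + 1)"
    using time_bound[of ?c] unfolding depth_program by blast
  then have "(\<lambda>n. real (time n ?c)) \<in> soft_O (\<lambda>n. real n ^ (k - s + 1))"
    by (rule polynomial_in_soft_O)
  ultimately show ?thesis by (intro exI conjI)
qed

end
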